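(* Let $\psi_1,\psi_2\in\Psi$, $A_1,A_2\in\mathcal{A}\setminus\{A_M\}$ and let $\tau_{A_1},\tau_{A_2}$ be the Kendall's $\tau$s of the extreme-value copulas $C_{A_1},C_{A_2}$. Suppose that $C_{\psi_1,A_1}(x,y)=C_{\psi_2,A_2}(x,y)$ for all $x,y\in\mathbb{I}$. Then $\psi_1=\psi_2$ on $[0,\infty)$ and $A_1=A_2$ on $\mathbb{I}$ if and only if $\tau_{A_1}=\tau_{A_2}$.
   Context: Write $\mathbb{I}=[0,1]$. $\Psi$ denotes the set of convex normalized (Archimedean) generators: continuous, non-increasing, convex $\psi:[0,\infty)\to\mathbb{I}$ with $\psi(0)=1$, $\lim_{z\to\infty}\psi(z)=0$, $\psi$ strictly decreasing on $[0,\inf\{x:\psi(x)=0\})$ (with $\inf\emptyset=\infty$), and $\psi(1)=\frac12$. The pseudo-inverse of $\psi$ is $\varphi:\mathbb{I}\to[0,\infty]$, $\varphi(y)=\inf\{z\in[0,\infty]:\psi(z)=y\}$ (with $\psi(\infty)=0$). $\mathcal{A}$ denotes the set of Pickands dependence functions, i.e. convex $A:\mathbb{I}\to\mathbb{I}$ with $\max\{1-x,x\}\le A(x)\le1$ for all $x$; $A_M(t)=\max\{t,1-t\}$. The extreme-value copula of $A$ is $C_A(x,y)=(xy)^{A(\log x/\log(xy))}$ on $(0,1)^2$, extended continuously to a copula on $\mathbb{I}^2$. Kendall's $\tau$ of a copula $C$ with associated measure $\mu_C$ is $\tau(C)=4\int_{\mathbb{I}^2}C\,d\mu_C-1$; $\tau_A:=\tau(C_A)$.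 For $\psi\in\Psi$ with pseudo-inverse $\varphi$ and $A\in\mathcal{A}$ the Archimax copula $C_{\psi,A}$ is given by $C_{\psi,A}(x,y)=\psi\big((\varphi(x)+\varphi(y))A\big(\frac{\varphi(x)}{\varphi(x)+\varphi(y)}\big)\big)$ on $(0,1)^2$, extended continuously to a copula on $\mathbb{I}^2$. *)

theory Defs
  imports "HOL-Probability.Probability"
begin

text \<open>
  Functions defined on \<open>[0,\<infinity>)\<close> or \<open>[0,1]\<close> are total functions \<open>real \<Rightarrow> real\<close> of which
  only the values on that domain matter; equality of such functions is therefore
  always stated on the domain.
\<close>

definition archimedean_generator :: "(real \<Rightarrow> real) \<Rightarrow> bool" where
  "archimedean_generator \<psi> \<longleftrightarrow>
     \<psi> \<in> {0..} \<rightarrow> {0..1} \<and>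
     continuous_on {0..} \<psi> \<and>
     antimono_on {0..} \<psi> \<and>
     convex_on {0..} \<psi> \<and>
     \<psi> 0 = 1 \<and>
     (\<psi> \<longlongrightarrow> 0) at_top \<and>
     strict_antimono_on {x. 0 \<le> x \<and> ereal x < Inf (ereal ` {z. 0 \<le> z \<and> \<psi> z = 0})} \<psi> \<and>
     \<psi> 1 = 1 / 2"

text \<open>The type \<^typ>\<open>ennreal\<close> is \<open>[0,\<infinity>]\<close>, and \<open>\<psi>\<close> is extended to it by \<open>\<psi> \<infinity> = 0\<close>.\<close>

definition pseudo_inverse :: "(real \<Rightarrow> real) \<Rightarrow> real \<Rightarrow> ennreal" where
  "pseudo_inverse \<psi> y = Inf {z. (if z = \<infinity> then 0 else \<psi> (enn2real z)) = y}"

definition pickands :: "(real \<Rightarrow> real) \<Rightarrow> bool" where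
  "pickands A \<longleftrightarrow>
     convex_on {0..1} A \<and> (\<forall>x\<in>{0..1}. max (1 - x) x \<le> A x \<and> A x \<le> 1)"

definition A_M :: "real \<Rightarrow> real" where
  "A_M t = max t (1 - t)"

text \<open>
  Every copula satisfies \<open>C x 0 = C 0 y = 0\<close>, \<open>C x 1 = x\<close> and \<open>C 1 y = y\<close>, so these are
  the boundary values of the extension to \<open>[0,1]\<^sup>2\<close> of a copula given on \<open>(0,1)\<^sup>2\<close>.
  Outside the unit square the value is that of the associated distribution function.
\<close>

definition copula_extension :: "(real \<Rightarrow> real \<Rightarrow> real) \<Rightarrow> real \<Rightarrow> real \<Rightarrow> real" where
  "copula_extension f x y =
     (if x \<le> 0 \<or> y \<le> 0 then 0
      else if 1 \<le> x then min y 1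
      else if 1 \<le> y then x
      else f x y)"

definition ev_copula :: "(real \<Rightarrow> real) \<Rightarrow> real \<Rightarrow> real \<Rightarrow> real" where
  "ev_copula A = copula_extension (\<lambda>x y. (x * y) powr A (ln x / ln (x * y)))"

text \<open>The pseudo-inverse of a generator is finite on \<open>(0,1)\<close>, so \<^const>\<open>enn2real\<close> loses nothing here.\<close>

definition archimax_copula :: "(real \<Rightarrow> real) \<Rightarrow> (real \<Rightarrow> real) \<Rightarrow> real \<Rightarrow> real \<Rightarrow> real" where
  "archimax_copula \<psi> A = copula_extension (\<lambda>x y.
     let u = enn2real (pseudo_inverse \<psi> x); v = enn2real (pseudo_inverse \<psi> y)
     in \<psi> ((u + v) * A (u / (u + v))))"

text \<open>
  The measure associated with a copula is taken on the Borel sets of the plane; being a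
  probability measure with mass \<open>C 1 1 = 1\<close> on \<open>[0,1]\<^sup>2\<close>, it is concentrated there and
  determined by its values on the rectangles \<open>[0,x] \<times> [0,y]\<close>.
\<close>

definition copula_measure :: "(real \<Rightarrow> real \<Rightarrow> real) \<Rightarrow> (real \<times> real) measure" where
  "copula_measure C = (THE M. prob_space M \<and> sets M = sets borel \<and>
     (\<forall>x\<in>{0..1}. \<forall>y\<in>{0..1}. measure M ({0..x} \<times> {0..y}) = C x y))"

definition kendall_tau :: "(real \<Rightarrow> real \<Rightarrow> real) \<Rightarrow> real" where
  "kendall_tau C = 4 * (LINT p:{0..1} \<times> {0..1}|copula_measure C. C (fst p) (snd p)) - 1"

end

theory Submission
  imports Defs
begin

text \<open>
  If the dependence functions agree, the extreme-value copulas are the same function, so only the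
  converse has content. Write \<open>\<ell> u v = (u + v) * A (u / (u + v))\<close> for the homogeneous
  convex function that \<open>A\<close> defines on the quadrant; the Archimax copula is \<open>\<psi> (\<ell> (\<phi> x) (\<phi> y))\<close> and the
  extreme-value copula is the case \<open>\<psi> z = exp (- z)\<close>.

  Equality of the two Archimax copulas means that \<open>g = \<phi>2 \<circ> \<psi>1\<close> satisfies \<open>g (\<ell>1 u v) = \<ell>2 (g u) (g v)\<close>.
  In logarithmic coordinates, call \<open>c\<close> a period of \<open>G = ln \<circ> g \<circ> exp\<close> if \<open>G (p + c) - G p\<close> is constant in \<open>p\<close>.
  Periods form a group that contains \<open>ln (\<ell>1 1 1)\<close>, which is positive because \<open>A1\<close> is not the lower bound,
  and that is closed under \<open>c \<mapsto> ln (\<ell>1 1 (exp c))\<close>. Since \<open>\<ell>1 1\<close> has slope at most one, this group has no least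
  positive element, so the monotone function \<open>G\<close> is affine and \<open>g u = u powr \<theta>\<close> with \<open>\<theta> > 0\<close>. Hence
  \<open>\<psi>1 u = \<psi>2 (u powr \<theta>)\<close> as long as \<open>\<psi>1 u > 0\<close>, and \<open>\<ell>1 u v powr \<theta> = \<ell>2 (u powr \<theta>) (v powr \<theta>)\<close>; this is
  \<open>archimax_copula_eq_imp_power_transform\<close>.

  It remains to see that \<open>\<theta> \<noteq> 1\<close> makes the two values of tau differ. By symmetry let \<open>\<theta> > 1\<close>. Monotonicity
  and homogeneity of \<open>\<ell>2\<close> give \<open>\<ell>1 \<le> \<ell>2\<close>, strictly where \<open>\<ell>2 u v > max u v\<close>. So the first extreme-value copula
  dominates the second, strictly on a rectangle near the diagonal that has positive mass. Kendall's tau is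
  strictly monotone in this situation (\<open>kendall_tau_strict_mono\<close>), because integrating one copula against the
  law of another is symmetric in the two. Using tau in this way requires that extreme-value copulas
  have a law at all, which \<open>ex_ev_copula_law\<close> provides by the conditional quantile construction.
\<close>

section \<open>Copulas, their laws and Kendall's tau\<close>

definition is_copula :: "(real \<Rightarrow> real \<Rightarrow> real) \<Rightarrow> bool" where
  "is_copula C \<longleftrightarrow>
     (\<forall>x\<in>{0..1}. C x 0 = 0 \<and> C 0 x = 0 \<and> C x 1 = x \<and> C 1 x = x) \<and>
     (\<forall>x\<in>{0..1}. \<forall>x'\<in>{x..1}. \<forall>y\<in>{0..1}. \<forall>y'\<in>{y..1}. C x y' + C x' y \<le> C x y + C x' y')"

definition copula_law :: "(real \<Rightarrow> real \<Rightarrow> real) \<Rightarrow> (real \<times> real) measure \<Rightarrow> bool" where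
  "copula_law C M \<longleftrightarrow> prob_space M \<and> sets M = sets borel \<and>
     (\<forall>x\<in>{0..1}. \<forall>y\<in>{0..1}. measure M ({0..x} \<times> {0..y}) = C x y)"

lemma is_copulaD:
  assumes "is_copula C"
  shows "\<And>x. 0 \<le> x \<Longrightarrow> x \<le> 1 \<Longrightarrow> C x 0 = 0" "\<And>x. 0 \<le> x \<Longrightarrow> x \<le> 1 \<Longrightarrow> C 0 x = 0"
    "\<And>x. 0 \<le> x \<Longrightarrow> x \<le> 1 \<Longrightarrow> C x 1 = x" "\<And>x. 0 \<le> x \<Longrightarrow> x \<le> 1 \<Longrightarrow> C 1 x = x"
    "\<And>x x' y y'. 0 \<le> x \<Longrightarrow> x \<le> x' \<Longrightarrow> x' \<le> 1 \<Longrightarrow> 0 \<le> y \<Longrightarrow> y \<le> y' \<Longrightarrow> y' \<le> 1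
       \<Longrightarrow> C x y' + C x' y \<le> C x y + C x' y'"
  using assms unfolding is_copula_def by auto

text \<open>
  The increment over an interval in one argument grows with the other argument, so it lies between
  its values at the margins 0 and 1.
\<close>

lemma copula_increment_left:
  assumes "is_copula C" "0 \<le> x" "x \<le> x'" "x' \<le> 1" "0 \<le> y" "y \<le> 1"
  shows "0 \<le> C x' y - C x y" "C x' y - C x y \<le> x' - x"
  using is_copulaD(5)[OF assms(1), of x x' 0 y] is_copulaD(5)[OF assms(1), of x x' y 1]
    is_copulaD(1,3)[OF assms(1)] assms by fastforce+

lemma copula_increment_right:
  assumes "is_copula C" "0 \<le> x" "x \<le> 1" "0 \<le> y" "y \<le> y'" "y' \<le> 1"
  shows "0 \<le> C x y' - C x y" "C x y' - C x y \<le> y' - y"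
  using is_copulaD(5)[OF assms(1), of 0 x y y'] is_copulaD(5)[OF assms(1), of x 1 y y']
    is_copulaD(2,4)[OF assms(1)] assms by fastforce+

lemma copula_law_AE_unit_square:
  assumes "copula_law C M" "C 1 1 = 1"
  shows "AE p in M. p \<in> {0..1} \<times> {0..1}"
proof -
  interpret prob_space M using assms by (simp add: copula_law_def)
  have "prob ({0..1} \<times> {0..1}) = 1" using assms by (simp add: copula_law_def)
  then show ?thesis
    using assms by (subst AE_in_set_eq_1) (auto simp: copula_law_def borel_prod[symmetric])
qed

lemma measure_atMost_copula_law:
  assumes "copula_law C M" "C 1 1 = 1"
  shows "measure M {..a} =
    (if 0 \<le> fst a \<and> 0 \<le> snd a then C (min (fst a) 1) (min (snd a) 1) else 0)"
proof -
  interpret prob_space M using assms by (simp add: copula_law_def)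
  have S[measurable_cong]: "sets M = sets borel" using assms by (simp add: copula_law_def)
  define B where "B = (if 0 \<le> fst a \<and> 0 \<le> snd a
    then {0..min (fst a) 1} \<times> {0..min (snd a) 1} else {} :: (real \<times> real) set)"
  have "measure M {..a} = measure M B"
  proof (rule finite_measure_eq_AE)
    show "AE p in M. p \<in> {..a} \<longleftrightarrow> p \<in> B"
      using copula_law_AE_unit_square[OF assms] by eventually_elim (auto simp: B_def less_eq_prod_def)
    show "{..a} \<in> sets M" unfolding S by simp
    show "B \<in> sets M" unfolding S B_def by (simp add: borel_prod[symmetric])
  qed
  also have "\<dots> = (if 0 \<le> fst a \<and> 0 \<le> snd a then C (min (fst a) 1) (min (snd a) 1) else 0)"
    using assms(1) by (simp add: B_def copula_law_def)
  finally show ?thesis .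
qed

text \<open>
  The quadrants \<open>{..a}\<close> of the product order form a generator of the Borel sets that is stable
  under intersection, and a law with mass one on the unit square takes prescribed values on them.
\<close>

lemma copula_law_unique:
  assumes "copula_law C M" "copula_law C N" "C 1 1 = 1"
  shows "M = N"
proof (rule measure_eqI_generator_eq[where A = "\<lambda>n. {..(real n, real n)}" and \<Omega> = UNIV])
  interpret M: prob_space M using assms by (simp add: copula_law_def)
  interpret N: prob_space N using assms by (simp add: copula_law_def)
  show "Int_stable (range (atMost :: real \<times> real \<Rightarrow> _))"
  proof (rule Int_stableI_image)
    fix a b :: "real \<times> real"
    have "{..a} \<inter> {..b} = {..inf a b}" by auto
    then show "\<exists>c\<in>UNIV. {..a} \<inter> {..b} = {..c}" by blast
  qed
  show "sets M = sigma_sets UNIV (range (atMost :: real \<times> real \<Rightarrow> _))"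
    "sets N = sigma_sets UNIV (range (atMost :: real \<times> real \<Rightarrow> _))"
    using assms by (simp_all add: copula_law_def borel_eq_atMost full_SetCompr_eq)
  show "(\<Union>i. {..(real i, real i)}) = (UNIV :: (real \<times> real) set)"
  proof -
    have "\<exists>i. p \<le> (real i, real i)" for p :: "real \<times> real"
      using real_arch_simple[of "max (fst p) (snd p)"] by (auto simp: less_eq_prod_def)
    then show ?thesis by auto
  qed
  show "emeasure M X = emeasure N X" if "X \<in> range (atMost :: real \<times> real \<Rightarrow> _)" for X
    using that measure_atMost_copula_law[OF assms(1,3)] measure_atMost_copula_law[OF assms(2,3)]
    by (auto simp: M.emeasure_eq_measure N.emeasure_eq_measure)
qed (auto simp: emeasure_eq_ennreal_measure finite_measure.emeasure_finite
    prob_space.finite_measure assms(1)[unfolded copula_law_def])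

lemma copula_measure_eqI:
  assumes "copula_law C M" "C 1 1 = 1"
  shows "copula_measure C = M"
  unfolding copula_measure_def copula_law_def[symmetric]
  using assms copula_law_unique by blast

context
  fixes C M
  assumes law: "copula_law C M" and cop: "is_copula C"
begin

lemma copula_law_marginals_uniform:
  shows "distributed M lborel fst (\<lambda>x. indicator {0..1::real} x / measure lborel {0..1::real})"
    and "distributed M lborel snd (\<lambda>x. indicator {0..1::real} x / measure lborel {0..1::real})"
proof -
  interpret prob_space M using law by (simp add: copula_law_def)
  have S[measurable_cong]: "sets M = sets (borel \<Otimes>\<^sub>M borel)"
    by (metis law copula_law_def borel_prod)
  have C11: "C 1 1 = 1" using is_copulaD(3)[OF cop] by simp
  have cdf: "prob ({0..x} \<times> {0..y}) = C x y" if "0 \<le> x" "x \<le> 1" "0 \<le> y" "y \<le> 1" for x y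
    using law that by (simp add: copula_law_def)
  have "prob {p \<in> space M. fst p \<le> t} = t" if "0 \<le> t" "t \<le> 1" for t
  proof -
    have "prob {p \<in> space M. fst p \<le> t} = prob ({0..t} \<times> {0..1})"
    proof (rule finite_measure_eq_AE)
      show "AE p in M. p \<in> {p \<in> space M. fst p \<le> t} \<longleftrightarrow> p \<in> {0..t} \<times> {0..1}"
        using copula_law_AE_unit_square[OF law C11] AE_space
        by eventually_elim (use that in auto)
      show "{0..t} \<times> {0..1} \<in> sets M" by (simp add: S)
    qed measurable
    then show ?thesis using cdf is_copulaD(3)[OF cop] that by simp
  qed
  then have "fst \<in> borel_measurable M \<and> (0::real) < 1 \<and> (\<forall>t\<in>{0..1}. prob {p \<in> space M. fst p \<le> t} = (t - 0) / (1 - 0))"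
    by simp
  then show "distributed M lborel fst (\<lambda>x. indicator {0..1} x / measure lborel {0..1::real})"
    by (rule uniform_distributed_iff[THEN iffD2])
  have "prob {p \<in> space M. snd p \<le> t} = t" if "0 \<le> t" "t \<le> 1" for t
  proof -
    have "prob {p \<in> space M. snd p \<le> t} = prob ({0..1} \<times> {0..t})"
    proof (rule finite_measure_eq_AE)
      show "AE p in M. p \<in> {p \<in> space M. snd p \<le> t} \<longleftrightarrow> p \<in> {0..1} \<times> {0..t}"
        using copula_law_AE_unit_square[OF law C11] AE_space
        by eventually_elim (use that in auto)
      show "{0..1} \<times> {0..t} \<in> sets M" by (simp add: S)
    qed measurable
    then show ?thesis using cdf is_copulaD(4)[OF cop] that by simp
  qed
  then have "snd \<in> borel_measurable M \<and> (0::real) < 1 \<and> (\<forall>t\<in>{0..1}. prob {p \<in> space M. snd p \<le> t} = (t - 0) / (1 - 0))"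
    by simp
  then show "distributed M lborel snd (\<lambda>x. indicator {0..1} x / measure lborel {0..1::real})"
    by (rule uniform_distributed_iff[THEN iffD2])
qed

lemma copula_law_no_atoms: "AE p in M. fst p \<noteq> x" "AE p in M. snd p \<noteq> y"
proof -
  interpret prob_space M using law by (simp add: copula_law_def)
  have null: "AE p in M. X p \<noteq> t"
    if D: "distributed M lborel X (\<lambda>x. indicator {0..1::real} x / measure lborel {0..1::real})"
    for X and t :: real
    by (subst distributed_AE2[OF D]) (use AE_lborel_singleton[of t] in auto)
  show "AE p in M. fst p \<noteq> x" "AE p in M. snd p \<noteq> y"
    by (rule null[OF copula_law_marginals_uniform(1)] null[OF copula_law_marginals_uniform(2)])+
qed

lemma copula_law_survival:
  assumes "0 \<le> x" "x \<le> 1" "0 \<le> y" "y \<le> 1"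
  shows "measure M {(x, y)..} = 1 - x - y + C x y"
proof -
  interpret prob_space M using law by (simp add: copula_law_def)
  have S[measurable_cong]: "sets M = sets (borel \<Otimes>\<^sub>M borel)"
    by (metis law copula_law_def borel_prod)
  have C11: "C 1 1 = 1" using is_copulaD(3)[OF cop] by simp
  have cdf: "prob ({0..x} \<times> {0..y}) = C x y" if "0 \<le> x" "x \<le> 1" "0 \<le> y" "y \<le> 1" for x y
    using law that by (simp add: copula_law_def)
  \<comment> \<open>The left and bottom strips of the unit square, whose union is, up to a null set, the complement of the quadrant.\<close>
  define L where "L = {0..x} \<times> {0..1::real}"
  define B where "B = {0..1::real} \<times> {0..y}"
  have [measurable]: "L \<in> sets M" "B \<in> sets M" by (auto simp: L_def B_def S)
  have "L \<inter> B = {0..x} \<times> {0..y}" using assms by (auto simp: L_def B_def)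
  then have LB: "prob L = x" "prob B = y" "prob (L \<inter> B) = C x y"
    using cdf assms is_copulaD(3,4)[OF cop] by (auto simp: L_def B_def)
  have "measure M {(x, y)..} = prob (space M - (L \<union> B))"
  proof (rule finite_measure_eq_AE)
    show "AE p in M. p \<in> {(x, y)..} \<longleftrightarrow> p \<in> space M - (L \<union> B)"
      using copula_law_AE_unit_square[OF law C11] AE_space
        copula_law_no_atoms(1)[of x] copula_law_no_atoms(2)[of y]
      by eventually_elim (auto simp: L_def B_def less_eq_prod_def)
    show "{(x, y)..} \<in> sets M"
      using law by (simp add: copula_law_def)
  qed simp
  also have "\<dots> = 1 - prob (L \<union> B)" by (rule prob_compl) simp
  also have "prob (L \<union> B) = x + y - C x y"
    using measure_Un3[of L M B] LB by (simp add: fmeasurable_eq_sets)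
  finally show ?thesis by simp
qed

lemma copula_law_mean:
  "integrable M fst" "integrable M snd" "(LINT p|M. fst p) = 1 / 2" "(LINT p|M. snd p) = 1 / 2"
proof -
  interpret prob_space M using law by (simp add: copula_law_def)
  have S[measurable_cong]: "sets M = sets (borel \<Otimes>\<^sub>M borel)"
    by (metis law copula_law_def borel_prod)
  have C11: "C 1 1 = 1" using is_copulaD(3)[OF cop] by simp
  have b: "AE p in M. norm (fst p) \<le> 1 \<and> norm (snd p) \<le> 1"
    using copula_law_AE_unit_square[OF law C11] by eventually_elim auto
  show "integrable M fst" "integrable M snd"
    using b by (intro integrable_const_bound[where B = 1]; auto)+
  show "(LINT p|M. fst p) = 1 / 2" "(LINT p|M. snd p) = 1 / 2"
    using uniform_distributed_expectation[OF copula_law_marginals_uniform(1)]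
      uniform_distributed_expectation[OF copula_law_marginals_uniform(2)] by simp_all
qed

end

text \<open>
  Both sides are the probability that \<open>q \<le> p\<close> for independent \<open>q\<close> with law \<open>M\<close> and \<open>p\<close> with
  law \<open>N\<close>; Fubini integrates out either variable first.
\<close>

lemma prob_pair_le_commute:
  fixes M N :: "('a :: ordered_euclidean_space) measure"
  assumes "prob_space M" "prob_space N" and S: "sets M = sets borel" "sets N = sets borel"
  shows "(LINT p|N. measure M {..p}) = (LINT q|M. measure N {q..})"
    and "integrable N (\<lambda>p. measure M {..p})"
    and "integrable M (\<lambda>q. measure N {q..})"
proof -
  interpret M: prob_space M by fact
  interpret N: prob_space N by fact
  interpret P: pair_prob_space M N ..
  define Q where "Q = {(q, p). q \<le> (p :: 'a)}"
  have "{z :: 'a \<times> 'a. fst z \<le> snd z} = (\<Inter>b\<in>Basis. {z. fst z \<bullet> b \<le> snd z \<bullet> b})"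
    by (auto simp: eucl_le[where 'a = 'a])
  also have "closed \<dots>"
    by (intro closed_INT ballI closed_Collect_le continuous_intros)
  finally have closed_le: "closed {z :: 'a \<times> 'a. fst z \<le> snd z}" .
  have Q: "Q \<in> sets (M \<Otimes>\<^sub>M N)"
  proof -
    have "Q = {z \<in> space (borel \<Otimes>\<^sub>M borel). fst z \<le> snd z}" by (auto simp: Q_def space_pair_measure)
    also have "\<dots> \<in> sets (borel \<Otimes>\<^sub>M borel)"
      unfolding borel_prod using closed_le by simp
    also have "\<dots> = sets (M \<Otimes>\<^sub>M N)" using S by (intro sets_pair_measure_cong) simp_all
    finally show ?thesis .
  qed
  have 1: "Pair q -` Q = {q..}" "(\<lambda>q. (q, p)) -` Q = {..p}" for q p by (auto simp: Q_def)
  have m1: "(\<lambda>q. emeasure N {q..}) \<in> borel_measurable M"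
    using N.measurable_emeasure_Pair[OF Q] by (simp add: 1)
  have m2: "(\<lambda>p. emeasure M {..p}) \<in> borel_measurable N"
    using P.measurable_emeasure_Pair2[OF Q] by (simp add: 1)
  have m1': "(\<lambda>q. measure N {q..}) \<in> borel_measurable M"
    and m2': "(\<lambda>p. measure M {..p}) \<in> borel_measurable N"
    unfolding measure_def using m1 m2 by measurable
  show int: "integrable N (\<lambda>p. measure M {..p})"
    by (rule N.integrable_const_bound[where B = 1]) (use m2' in auto)
  show "integrable M (\<lambda>q. measure N {q..})"
    by (rule M.integrable_const_bound[where B = 1]) (use m1' in auto)
  have "(\<integral>\<^sup>+p. emeasure M {..p} \<partial>N) = emeasure (M \<Otimes>\<^sub>M N) Q"
    using P.emeasure_pair_measure_alt2[OF Q] by (simp add: 1)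
  also have "\<dots> = (\<integral>\<^sup>+q. emeasure N {q..} \<partial>M)"
    using N.emeasure_pair_measure_alt[OF Q] by (simp add: 1)
  finally have "(\<integral>\<^sup>+p. ennreal (measure M {..p}) \<partial>N) = (\<integral>\<^sup>+q. ennreal (measure N {q..}) \<partial>M)"
    by (simp add: M.emeasure_eq_measure N.emeasure_eq_measure)
  then show "(LINT p|N. measure M {..p}) = (LINT q|M. measure N {q..})"
    using m1' m2' by (simp add: integral_eq_nn_integral)
qed

text \<open>
  Integrating the distribution function of one copula against the law of another is symmetric
  in the two copulas. Exchanging the order of integration turns the distribution function of \<open>N\<close>
  into the survival function \<open>1 - x - y + C x y\<close> of \<open>M\<close>, and the terms \<open>1 - x - y\<close> integrate to zero
  because the marginals are uniform, hence have mean \<open>1/2\<close>.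
\<close>

lemma copula_law_exchange:
  assumes "copula_law C M" "is_copula C" "copula_law D N" "is_copula D"
  shows "(LINT p|M. measure N {..p}) = (LINT p|N. measure M {..p})"
    and "integrable M (\<lambda>p. measure N {..p})"
proof -
  interpret M: prob_space M using assms by (simp add: copula_law_def)
  interpret N: prob_space N using assms by (simp add: copula_law_def)
  have S: "sets M = sets borel" "sets N = sets borel" using assms by (simp_all add: copula_law_def)
  have C11: "C 1 1 = 1" "D 1 1 = 1" using is_copulaD(3) assms by auto
  note pair = prob_pair_le_commute[OF N.prob_space_axioms M.prob_space_axioms S(2,1)]
  note pair' = prob_pair_le_commute[OF M.prob_space_axioms N.prob_space_axioms S]
  show "integrable M (\<lambda>p. measure N {..p})" by (rule pair(2))
  have "(LINT p|M. measure N {..p}) = (LINT q|N. measure M {q..})" by (rule pair(1))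
  also have "\<dots> = (LINT q|N. 1 - fst q - snd q + measure M {..q})"
  proof (rule integral_cong_AE)
    have eq: "AE q in N. measure M {q..} = 1 - fst q - snd q + measure M {..q}"
      using copula_law_AE_unit_square[OF assms(3) C11(2)]
    proof eventually_elim
      case (elim q)
      then show ?case
        using copula_law_survival[OF assms(1,2), of "fst q" "snd q"]
          measure_atMost_copula_law[OF assms(1) C11(1), of q]
        by (auto simp: min_absorb1)
    qed
    show "AE q in N. measure M {q..} = 1 - fst q - snd q + measure M {..q}" by (rule eq)
    show m: "(\<lambda>q. 1 - fst q - snd q + measure M {..q}) \<in> borel_measurable N"
      using pair'(2) copula_law_mean(1,2)[OF assms(3,4)] by measurable
    show "(\<lambda>q. measure M {q..}) \<in> borel_measurable N"
      using pair(3) by simp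
  qed
  also have "\<dots> = 1 - 1 / 2 - 1 / 2 + (LINT q|N. measure M {..q})"
    using pair'(2) copula_law_mean[OF assms(3,4)] by (simp add: N.prob_space)
  finally show "(LINT p|M. measure N {..p}) = (LINT p|N. measure M {..p})" by simp
qed

lemma kendall_tau_eq_LINT:
  assumes "copula_law C M" "is_copula C"
  shows "kendall_tau C = 4 * (LINT p|M. measure M {..p}) - 1"
proof -
  have C11: "C 1 1 = 1" using is_copulaD(3) assms by auto
  interpret M: prob_space M using assms by (simp add: copula_law_def)
  have S: "sets M = sets borel" using assms by (simp add: copula_law_def)
  have int: "integrable M (\<lambda>p. measure M {..p})"
    by (rule copula_law_exchange(2)) fact+
  have "(LINT p:{0..1} \<times> {0..1}|M. C (fst p) (snd p))
      = (LINT p|M. indicator ({0..1} \<times> {0..1}) p * measure M {..p})"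
    unfolding set_lebesgue_integral_def
    by (intro Bochner_Integration.integral_cong)
      (auto simp: indicator_def measure_atMost_copula_law[OF assms(1) C11] min_absorb1)
  also have "\<dots> = (LINT p|M. measure M {..p})"
  proof (rule integral_cong_AE)
    show "AE p in M. indicator ({0..1} \<times> {0..1}) p * measure M {..p} = measure M {..p}"
      using copula_law_AE_unit_square[OF assms(1) C11] by eventually_elim auto
    have "{0..1} \<times> {0..1 :: real} \<in> sets M" 
      unfolding S borel_prod[symmetric] by simp
    then show "(\<lambda>p. indicator ({0..1} \<times> {0..1}) p * measure M {..p}) \<in> borel_measurable M"
      using int by measurable
  qed (use int in auto)
  finally show ?thesis
    unfolding kendall_tau_def copula_measure_eqI[OF assms(1) C11] by simp
qed

text \<open>
  Kendall's tau respects the concordance order: if \<open>C \<le> D\<close>, then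
  \<open>\<integral>C dM \<le> \<integral>D dM = \<integral>C dN \<le> \<integral>D dN\<close> by the exchange formula. The first inequality is strict as soon as
  \<open>C < D\<close> holds on a rectangle to which \<open>C\<close> gives positive mass.
\<close>

lemma kendall_tau_strict_mono:
  assumes C: "copula_law C M" "is_copula C" and D: "copula_law D N" "is_copula D"
    and le: "\<And>x y. 0 \<le> x \<Longrightarrow> x \<le> 1 \<Longrightarrow> 0 \<le> y \<Longrightarrow> y \<le> 1 \<Longrightarrow> C x y \<le> D x y"
    and R: "0 \<le> a" "a \<le> a'" "a' \<le> 1" "0 \<le> b" "b \<le> b'" "b' \<le> 1"
    and less: "\<And>x y. a < x \<Longrightarrow> x \<le> a' \<Longrightarrow> b < y \<Longrightarrow> y \<le> b' \<Longrightarrow> C x y < D x y"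
    and mass: "C a b' + C a' b < C a b + C a' b'"
  shows "kendall_tau C < kendall_tau D"
proof -
  have C11: "C 1 1 = 1" "D 1 1 = 1" using is_copulaD(3) assms by auto
  interpret M: prob_space M using assms by (simp add: copula_law_def)
  interpret N: prob_space N using assms by (simp add: copula_law_def)
  have S: "sets M = sets borel" "sets N = sets borel" using assms by (simp_all add: copula_law_def)
  note cdf = measure_atMost_copula_law[OF C(1) C11(1)] measure_atMost_copula_law[OF D(1) C11(2)]
  have le': "measure M {..p} \<le> measure N {..p}" for p
    unfolding cdf using le by (auto simp: min_def)
  have "(LINT p|M. measure M {..p}) < (LINT p|M. measure N {..p})"
  proof (rule M.integral_less_AE)
    let ?B = "{..(a, b')} \<union> {..(a', b)}"
    let ?A = "{..(a', b')} - ?B"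
    have sets: "{..p} \<in> sets M" for p unfolding S by simp
    show "?A \<in> sets M" using sets by auto
    have cut: "{..(a, b')} \<inter> {..(a', b)} = {..(a, b)}" using R by auto
    have "M.prob ?B = C a b' + C a' b - C a b"
      using measure_Un3[of "{..(a, b')}" M "{..(a', b)}"] sets cdf R
      by (simp add: cut M.fmeasurable_eq_sets M.emeasure_finite min_absorb1)
    moreover have "M.prob ?A = M.prob {..(a', b')} - M.prob ?B"
      by (rule M.finite_measure_Diff) (use sets R in auto)
    ultimately have "M.prob ?A > 0" using mass cdf R by (simp add: min_absorb1)
    then show "emeasure M ?A \<noteq> 0" by (simp add: M.emeasure_eq_measure)
    show "AE p\<in>?A in M. measure M {..p} \<noteq> measure N {..p}"
    proof (intro AE_I2 impI)
      fix p assume "p \<in> ?A"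
      then have "a < fst p" "fst p \<le> a'" "b < snd p" "snd p \<le> b'"
        by (cases p; auto)+
      then show "measure M {..p} \<noteq> measure N {..p}"
        using less[of "fst p" "snd p"] R by (simp add: cdf min_absorb1)
    qed
  qed (use copula_law_exchange(2) C D le' in auto)
  also have "\<dots> = (LINT p|N. measure M {..p})" by (rule copula_law_exchange) fact+
  also have "\<dots> \<le> (LINT p|N. measure N {..p})"
    by (rule integral_mono) (use copula_law_exchange(2) C D le' in auto)
  finally show ?thesis
    unfolding kendall_tau_eq_LINT[OF C] kendall_tau_eq_LINT[OF D] by simp
qed

section \<open>Existence of the law of a copula\<close>

lemma tendsto_right_difference_quotient:
  fixes f :: "real \<Rightarrow> real"
  assumes "(f has_field_derivative d) (at t within S)" "eventually (\<lambda>n. t + 1 / real (Suc n) \<in> S) sequentially"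
  shows "(\<lambda>n. real (Suc n) * (f (t + 1 / real (Suc n)) - f t)) \<longlonglongrightarrow> d"
proof -
  have "(\<lambda>n. t + 1 / real (Suc n)) \<longlonglongrightarrow> t + 0"
    by (intro tendsto_intros LIMSEQ_Suc[OF lim_1_over_n])
  then have "filterlim (\<lambda>n. t + 1 / real (Suc n)) (at t within S) sequentially"
    unfolding filterlim_at using assms(2) by (auto elim: eventually_mono)
  from filterlim_compose[OF assms(1)[unfolded has_field_derivative_iff] this]
  show ?thesis by (simp add: field_simps)
qed

text \<open>
  After a shift of the integration variable, the integral is the difference between the difference
  quotients at \<open>x\<close> and at \<open>0\<close> of an antiderivative of \<open>f\<close>.
\<close>

lemma tendsto_LINT_difference_quotient:
  fixes f :: "real \<Rightarrow> real"
  assumes f: "continuous_on UNIV f" and x: "0 \<le> x"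
  shows "(\<lambda>n. LINT s:{0..x}|lborel. real (Suc n) * (f (s + 1 / real (Suc n)) - f s)) \<longlonglongrightarrow> f x - f 0"
proof -
  define \<Phi> where "\<Phi> t = integral {0..t} f" for t
  have der: "(\<lambda>n. real (Suc n) * (\<Phi> (t + 1 / real (Suc n)) - \<Phi> t)) \<longlonglongrightarrow> f t" if "0 \<le> t" for t
  proof (rule tendsto_right_difference_quotient)
    show "(\<Phi> has_field_derivative f t) (at t within {0..t + 1})"
      unfolding \<Phi>_def
      by (rule integral_has_real_derivative) (use that continuous_on_subset[OF f] in auto)
  qed (use that in auto)
  have cont: "continuous_on S f" for S using f continuous_on_subset by blast
  have int: "f integrable_on {a..b}" for a b
    by (rule integrable_continuous_interval[OF cont])
  have eq: "(LINT s:{0..x}|lborel. real (Suc n) * (f (s + 1 / real (Suc n)) - f s)) =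
    real (Suc n) * (\<Phi> (x + 1 / real (Suc n)) - \<Phi> x) - real (Suc n) * (\<Phi> (0 + 1 / real (Suc n)) - \<Phi> 0)" for n
  proof -
    define h where "h = 1 / real (Suc n)"
    have h: "0 < h" by (simp add: h_def)
    have shift: "continuous_on S (\<lambda>s. f (s + h))" for S
      by (rule continuous_on_compose2[OF f]) (auto intro!: continuous_intros)
    have c: "continuous_on {0..x} (\<lambda>s. real (Suc n) * (f (s + h) - f s))"
      by (intro continuous_intros shift cont)
    have "(LINT s:{0..x}|lborel. real (Suc n) * (f (s + h) - f s)) =
      integral {0..x} (\<lambda>s. real (Suc n) * (f (s + h) - f s))"
      by (rule set_borel_integral_eq_integral) (rule borel_integrable_atLeastAtMost'[OF c])
    also have "\<dots> = real (Suc n) * (integral {0..x} (\<lambda>s. f (s + h)) - \<Phi> x)"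
      unfolding \<Phi>_def
      by (simp add: integral_diff integrable_continuous_interval[OF shift] int)
    also have "integral {0..x} (\<lambda>s. f (s + h)) = integral {h..x + h} f"
      using integral_shift[where a = 0 and b = x and f = f and c = h] shift cont by (simp add: o_def add.commute)
    also have "\<dots> = \<Phi> (x + h) - \<Phi> h"
      unfolding \<Phi>_def
      using Henstock_Kurzweil_Integration.integral_combine[of 0 h "x + h" f] x h int by simp
    finally show ?thesis by (simp add: h_def \<Phi>_def algebra_simps)
  qed
  show ?thesis unfolding eq by (intro tendsto_diff der x order.refl)
qed

lemma prob_space_unit_interval: "prob_space (restrict_space lborel {0<..<1::real})"
  by (rule prob_space_restrict_space) auto

text \<open>
  A random vector with distribution function \<open>C\<close> is built by conditional quantiles. The right
  derivative \<open>F x y\<close> of \<open>C\<close> in its first argument is the conditional distribution function of the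
  second coordinate at \<open>y\<close> given that the first one equals \<open>x\<close>. For independent uniform \<open>x\<close> and
  \<open>r\<close> the vector is \<open>(x, Inf {y. r \<le> F x y})\<close>. As \<open>F x\<close> need not be right-continuous, the events
  \<open>r \<le> F x y\<close> and \<open>Inf \<dots> \<le> y\<close> may differ; they are squeezed between each other for slightly larger \<open>y\<close>,
  and the gap closes because \<open>C\<close> is Lipschitz in \<open>y\<close>.
\<close>

lemma ex_copula_law:
  assumes cop: "is_copula C"
    and conv: "\<And>x y. 0 < x \<Longrightarrow> x < 1 \<Longrightarrow> 0 < y \<Longrightarrow> y < 1 \<Longrightarrow>
      convergent (\<lambda>n. real (Suc n) * (C (x + 1 / real (Suc n)) y - C x y))"
  shows "\<exists>M. copula_law C M"
proof -
  \<comment> \<open>Difference quotients near 1 leave the unit interval; clamping keeps them defined and bounded.\<close>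
  define clamp :: "real \<Rightarrow> real" where "clamp s = max 0 (min s 1)" for s
  have clamp: "0 \<le> clamp s" "clamp s \<le> 1" for s by (auto simp: clamp_def)
  have clamp_increment: "clamp s \<le> clamp t" "clamp t - clamp s \<le> t - s" if "s \<le> t" for s t
    using that by (auto simp: clamp_def)
  define Q where "Q n y s = real (Suc n) * (C (clamp (s + 1 / real (Suc n))) y - C (clamp s) y)" for n y s
  define F where "F s y = lim (\<lambda>n. Q n y s)" for s y
  have cont: "continuous_on UNIV (\<lambda>s. C (clamp s) y)" if "0 < y" "y < 1" for y
  proof (rule lipschitz_on_continuous_on[where L = 1], rule lipschitz_on_leI)
    fix s t :: real assume "s \<le> t"
    note clamp_increment[OF this]
    then show "dist (C (clamp s) y) (C (clamp t) y) \<le> 1 * dist s t"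
      using copula_increment_left[OF cop, of "clamp s" "clamp t" y] clamp that \<open>s \<le> t\<close>
      by (auto simp: dist_real_def)
  qed auto
  have Q_meas[measurable]: "Q n y \<in> borel_measurable borel" if "0 < y" "y < 1" for n y
    unfolding Q_def
    using measurable_compose[OF _ borel_measurable_continuous_onI[OF cont[OF that]],
        of "\<lambda>s. s + 1 / real (Suc n)" borel]
      borel_measurable_continuous_onI[OF cont[OF that]] by measurable
  have F_meas[measurable]: "(\<lambda>s. F s y) \<in> borel_measurable borel" if "0 < y" "y < 1" for y
    unfolding F_def using Q_meas[OF that] by (rule borel_measurable_lim_metric)
  have Q_mono: "Q n y s \<le> Q n y' s" if "0 \<le> y" "y \<le> y'" "y' \<le> 1" for n y y' s
  proof -
    have "clamp s \<le> clamp (s + 1 / real (Suc n))" by (rule clamp_increment) simp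
    from is_copulaD(5)[OF cop, OF _ this _ that] show ?thesis
      unfolding Q_def using clamp by (intro mult_left_mono) auto
  qed
  have Q_bounds: "0 \<le> Q n y s" "Q n y s \<le> 1" if "0 \<le> y" "y \<le> 1" for n y s
  proof -
    have *: "clamp s \<le> clamp (s + 1 / real (Suc n))"
      "clamp (s + 1 / real (Suc n)) - clamp s \<le> 1 / real (Suc n)"
      using clamp_increment[of s "s + 1 / real (Suc n)"] by simp_all
    note inc = copula_increment_left[OF cop clamp(1) *(1) clamp(2) that]
    show "0 \<le> Q n y s" unfolding Q_def using inc(1) by simp
    have "Q n y s \<le> real (Suc n) * (1 / real (Suc n))"
      unfolding Q_def using inc(2) *(2) by (intro mult_left_mono) linarith+
    then show "Q n y s \<le> 1" by simp
  qed
  have Q_lim: "(\<lambda>n. Q n y s) \<longlonglongrightarrow> F s y" if "0 < s" "s < 1" "0 < y" "y < 1" for s y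
  proof -
    have "eventually (\<lambda>n. 1 / real (Suc n) < 1 - s) sequentially"
      using order_tendstoD(2)[OF LIMSEQ_Suc[OF lim_1_over_n], of "1 - s"] that by simp
    then have "eventually (\<lambda>n. Q n y s = real (Suc n) * (C (s + 1 / real (Suc n)) y - C s y)) sequentially"
    proof eventually_elim
      case (elim n)
      have "clamp s = s" "clamp (s + 1 / real (Suc n)) = s + 1 / real (Suc n)"
        using elim that by (auto simp: clamp_def)
      then show ?case by (simp only: Q_def)
    qed
    from convergent_cong[OF this] conv[OF that] have "convergent (\<lambda>n. Q n y s)" by blast
    then show ?thesis unfolding F_def by (simp add: convergent_LIMSEQ_iff)
  qed
  have F_bounds: "0 \<le> F s y" "F s y \<le> 1" if "0 < s" "s < 1" "0 < y" "y < 1" for s y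
    using LIMSEQ_le_const[OF Q_lim[OF that]] LIMSEQ_le_const2[OF Q_lim[OF that]] Q_bounds that
    by (meson less_imp_le)+
  have F_mono: "F s y \<le> F s y'" if "0 < s" "s < 1" "0 < y" "y \<le> y'" "y' < 1" for s y y'
    using that Q_mono by (intro LIMSEQ_le[OF Q_lim Q_lim]) auto
  have F_integral: "integrable lborel (\<lambda>s. indicator {0..x} s * F s y)"
    "(LINT s|lborel. indicator {0..x} s * F s y) = C x y"
    if x: "0 \<le> x" "x \<le> 1" and y: "0 < y" "y < 1" for x y
  proof -
    have [measurable]: "Q n y \<in> borel_measurable borel" "(\<lambda>s. F s y) \<in> borel_measurable borel" for n
      using Q_meas F_meas y by blast+
    have AE: "AE s in lborel. (\<lambda>n. indicator {0..x} s * Q n y s) \<longlonglongrightarrow> indicator {0..x} s * F s y"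
      using AE_lborel_singleton[of 0] AE_lborel_singleton[of 1]
    proof eventually_elim
      case (elim s)
      show ?case
      proof (cases "s \<in> {0..x}")
        case True
        then show ?thesis using elim x y by (intro tendsto_mult_left Q_lim) auto
      qed simp
    qed
    have w: "integrable lborel (indicator {0..x} :: real \<Rightarrow> real)"
      by (simp add: integrable_indicator_iff emeasure_lborel_Icc_eq)
    have bd: "AE s in lborel. norm (indicator {0..x} s * Q n y s) \<le> indicator {0..x} s" for n
      using Q_bounds[of y n] y by (intro AE_I2) (auto simp: indicator_def)
    show "integrable lborel (\<lambda>s. indicator {0..x} s * F s y)"
      by (rule integrable_dominated_convergence[OF _ _ w AE bd]) auto
    have "(\<lambda>n. LINT s|lborel. indicator {0..x} s * Q n y s) \<longlonglongrightarrow> (LINT s|lborel. indicator {0..x} s * F s y)"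
      by (rule integral_dominated_convergence[OF _ _ w AE bd]) auto
    moreover have "(\<lambda>n. LINT s|lborel. indicator {0..x} s * Q n y s) \<longlonglongrightarrow> C (clamp x) y - C (clamp 0) y"
      using tendsto_LINT_difference_quotient[OF cont[OF y] x(1)]
      by (simp only: Q_def set_lebesgue_integral_def real_scaleR_def)
    ultimately show "(LINT s|lborel. indicator {0..x} s * F s y) = C x y"
      using x y is_copulaD(2)[OF cop] LIMSEQ_unique by (fastforce simp: clamp_def)
  qed
  define U where "U = restrict_space lborel {0<..<1::real}"
  interpret U: prob_space U unfolding U_def by (rule prob_space_unit_interval)
  interpret UU: pair_prob_space U U ..
  have space: "space U = {0<..<1}" by (simp add: U_def space_restrict_space)
  have [measurable]: "(\<lambda>s. s) \<in> measurable U borel"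
    unfolding U_def by (rule measurable_restrict_space1) simp
  have U_le: "emeasure U {r \<in> space U. r \<le> f} = ennreal f" if "0 \<le> f" "f \<le> 1" for f
  proof -
    have "emeasure U {r \<in> space U. r \<le> f} = emeasure lborel ({0<..<1} \<inter> {..f})"
      unfolding U_def by (subst emeasure_restrict_space) (auto simp: space_restrict_space intro!: arg_cong[where f = "emeasure lborel"])
    also have "{0<..<1} \<inter> {..f} = (if f = 1 then {0<..<1} else {0<..f})" using that by auto
    finally show ?thesis using that by simp
  qed
  define Z where "Z x y = {p \<in> space (U \<Otimes>\<^sub>M U). fst p \<le> x \<and> snd p \<le> F (fst p) y}" for x y
  have Z_sets[measurable]: "Z x y \<in> sets (U \<Otimes>\<^sub>M U)" if "0 < y" "y < 1" for x y
  proof -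
    have "(\<lambda>p. F (fst p) y) \<in> borel_measurable (U \<Otimes>\<^sub>M U)"
      by (rule measurable_compose[OF _ F_meas[OF that]]) measurable
    then show ?thesis unfolding Z_def by measurable
  qed
  have Z: "UU.prob (Z x y) = C x y" if x: "0 \<le> x" "x \<le> 1" and y: "0 < y" "y < 1" for x y
  proof -
    have "emeasure (U \<Otimes>\<^sub>M U) (Z x y) = (\<integral>\<^sup>+s. emeasure U (Pair s -` Z x y) \<partial>U)"
      by (rule U.emeasure_pair_measure_alt[OF Z_sets[OF y]])
    also have "\<dots> = (\<integral>\<^sup>+s. ennreal (indicator {0..x} s * F s y) \<partial>U)"
    proof (rule nn_integral_cong)
      fix s assume s: "s \<in> space U"
      show "emeasure U (Pair s -` Z x y) = ennreal (indicator {0..x} s * F s y)"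
      proof (cases "s \<le> x")
        case True
        then have "Pair s -` Z x y = {r \<in> space U. r \<le> F s y}"
          using s by (auto simp: Z_def space_pair_measure)
        then show ?thesis using True U_le[of "F s y"] F_bounds s y by (simp add: space)
      next
        case False
        then have "Pair s -` Z x y = {}" by (auto simp: Z_def)
        then show ?thesis using False by simp
      qed
    qed
    also have "\<dots> = (\<integral>\<^sup>+s. ennreal (indicator {0..x} s * F s y) * indicator {0<..<1} s \<partial>lborel)"
      unfolding U_def by (rule nn_integral_restrict_space) simp
    also have "\<dots> = (\<integral>\<^sup>+s. ennreal (indicator {0..x} s * F s y) \<partial>lborel)"
    proof (rule nn_integral_cong_AE)
      show "AE s in lborel. ennreal (indicator {0..x} s * F s y) * indicator {0<..<1} s
        = ennreal (indicator {0..x} s * F s y)"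
        using AE_lborel_singleton[of 0] AE_lborel_singleton[of 1]
        by eventually_elim (use x in \<open>auto simp: indicator_def\<close>)
    qed
    also have "\<dots> = ennreal (C x y)"
    proof (subst nn_integral_eq_integral)
      show "AE s in lborel. 0 \<le> indicator {0..x} s * F s y"
        using AE_lborel_singleton[of 0] AE_lborel_singleton[of 1]
        by eventually_elim (use x y F_bounds in \<open>auto simp: indicator_def\<close>)
    qed (use F_integral[OF x y] in auto)
    finally show ?thesis
      using copula_increment_left(1)[OF cop, of 0 x y] is_copulaD(2)[OF cop] x y
      by (simp add: measure_def)
  qed
  \<comment> \<open>Membership of 1 keeps the set nonempty, and the restriction to positive y makes the infimum nonnegative.\<close>
  define S where "S p = {y. 0 < y \<and> (1 \<le> y \<or> snd p \<le> F (fst p) y)}" for p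
  define Y where "Y p = Inf (S p)" for p
  have S1: "1 \<in> S p" for p by (simp add: S_def)
  have S_below: "bdd_below (S p)" for p by (rule bdd_belowI[of _ 0]) (auto simp: S_def)
  have S_up: "z' \<in> S p" if "z \<in> S p" "z \<le> z'" "p \<in> space (U \<Otimes>\<^sub>M U)" for z z' p
    using that F_mono[of "fst p" z z'] by (fastforce simp: S_def space_pair_measure space)
  have Y_less: "Y p < t \<longleftrightarrow> (\<exists>z\<in>S p. z < t)" for p t
    unfolding Y_def using S1[of p] S_below[of p] by (subst cInf_less_iff) auto
  have Y_nonneg: "0 \<le> Y p" for p
    unfolding Y_def using S1[of p] by (intro cInf_greatest) (blast, simp add: S_def)
  have Y_le_1: "Y p \<le> 1" for p
    unfolding Y_def by (rule cInf_lower[OF S1 S_below])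
  have Y_meas[measurable]: "Y \<in> borel_measurable (U \<Otimes>\<^sub>M U)"
  proof (subst borel_measurable_iff_less, intro allI)
    fix t
    \<comment> \<open>By monotonicity of F in y rational levels suffice.\<close>
    have "{p \<in> space (U \<Otimes>\<^sub>M U). Y p < t} =
      (\<Union>q\<in>{q::rat. 0 < q \<and> real_of_rat q < t}.
        if 1 \<le> q then space (U \<Otimes>\<^sub>M U) else {p \<in> space (U \<Otimes>\<^sub>M U). snd p \<le> F (fst p) (real_of_rat q)})"
      (is "?L = ?R")
    proof (intro set_eqI iffI)
      fix p assume "p \<in> ?L"
      then obtain z where z: "z \<in> S p" "z < t" and p: "p \<in> space (U \<Otimes>\<^sub>M U)" by (auto simp: Y_less)
      obtain q where q: "z < real_of_rat q" "real_of_rat q < t" using of_rat_dense z(2) by blast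
      then have "real_of_rat q \<in> S p" using S_up z p by fastforce
      then show "p \<in> ?R" using q p by (auto simp: S_def intro!: bexI[of _ q] split: if_splits)
    next
      fix p assume "p \<in> ?R"
      then obtain q :: rat where "0 < q" "real_of_rat q < t" "p \<in> space (U \<Otimes>\<^sub>M U)"
        "1 \<le> q \<or> snd p \<le> F (fst p) (real_of_rat q)" by (auto split: if_splits)
      then have "real_of_rat q \<in> S p" by (auto simp: S_def)
      then show "p \<in> ?L" using \<open>real_of_rat q < t\<close> \<open>p \<in> space _\<close> by (auto simp: Y_less)
    qed
    also have "?R \<in> sets (U \<Otimes>\<^sub>M U)"
    proof (intro sets.countable_UN'' countableI_type)
      fix q :: rat assume q: "q \<in> {q. 0 < q \<and> real_of_rat q < t}"
      show "(if 1 \<le> q then space (U \<Otimes>\<^sub>M U)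
        else {p \<in> space (U \<Otimes>\<^sub>M U). snd p \<le> F (fst p) (real_of_rat q)}) \<in> sets (U \<Otimes>\<^sub>M U)"
      proof (cases "1 \<le> q")
        case False
        then have "(\<lambda>p. F (fst p) (real_of_rat q)) \<in> borel_measurable (U \<Otimes>\<^sub>M U)"
          using q by (intro measurable_compose[OF _ F_meas]) (auto, measurable)
        then show ?thesis using False by simp measurable
      qed simp
    qed
    finally show "{p \<in> space (U \<Otimes>\<^sub>M U). Y p < t} \<in> sets (U \<Otimes>\<^sub>M U)" .
  qed
  define M where "M = distr (U \<Otimes>\<^sub>M U) borel (\<lambda>p. (fst p, Y p))"
  have XY[measurable]: "(\<lambda>p. (fst p, Y p)) \<in> measurable (U \<Otimes>\<^sub>M U) borel"
    unfolding borel_prod[symmetric] by measurable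
  have "measure M ({0..x} \<times> {0..y}) = C x y" if x: "0 \<le> x" "x \<le> 1" and y: "0 \<le> y" "y \<le> 1" for x y
  proof -
    define E where "E = {p \<in> space (U \<Otimes>\<^sub>M U). fst p \<le> x \<and> Y p \<le> y}"
    have [measurable]: "E \<in> sets (U \<Otimes>\<^sub>M U)" unfolding E_def by measurable
    have "measure M ({0..x} \<times> {0..y}) = UU.prob ((\<lambda>p. (fst p, Y p)) -` ({0..x} \<times> {0..y}) \<inter> space (U \<Otimes>\<^sub>M U))"
      unfolding M_def by (rule measure_distr[OF XY]) (simp add: borel_prod[symmetric])
    also have "(\<lambda>p. (fst p, Y p)) -` ({0..x} \<times> {0..y}) \<inter> space (U \<Otimes>\<^sub>M U) = E"
      using Y_nonneg by (auto simp: E_def space_pair_measure space)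
    also have "UU.prob E = C x y"
    proof (cases "y = 1")
      case True
      have E: "E = {s \<in> space U. s \<le> x} \<times> space U"
        using Y_le_1 True by (auto simp: E_def space_pair_measure)
      have sets: "{s \<in> space U. s \<le> x} \<in> sets U" by measurable
      have "emeasure (U \<Otimes>\<^sub>M U) E = ennreal x"
        unfolding E U.emeasure_pair_measure_Times[OF sets sets.top] U_le[OF x] U.emeasure_space_1 by simp
      then show ?thesis using x is_copulaD(3)[OF cop x] by (simp add: measure_def True)
    next
      case False
      show ?thesis
      proof (rule antisym)
        show "C x y \<le> UU.prob E"
        proof (cases "y = 0")
          case True
          then show ?thesis using is_copulaD(1)[OF cop] x by simp
        next
          case False
          have "Z x y \<subseteq> E"
            using \<open>y \<noteq> 0\<close> y S_below by (auto simp: Z_def E_def Y_def S_def intro!: cInf_lower)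
          then have "UU.prob (Z x y) \<le> UU.prob E" by (rule UU.finite_measure_mono) measurable
          moreover have "UU.prob (Z x y) = C x y" using \<open>y \<noteq> 0\<close> \<open>y \<noteq> 1\<close> y by (intro Z x) auto
          ultimately show ?thesis by simp
        qed
        show "UU.prob E \<le> C x y"
        proof (rule field_le_epsilon)
          fix e :: real assume "0 < e"
          define y' where "y' = min (y + e) ((y + 1) / 2)"
          have y': "y < y'" "y' < 1" "y' \<le> y + e" using \<open>0 < e\<close> y False by (auto simp: y'_def min_def)
          have "E \<subseteq> Z x y'"
          proof
            fix p assume p: "p \<in> E"
            then have "Y p < y'" using y' by (auto simp: E_def)
            then obtain z where "z \<in> S p" "z < y'" by (auto simp: Y_less)
            then have "y' \<in> S p" using S_up[of z p y'] p by (simp add: E_def)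
            then show "p \<in> Z x y'" using p y' by (auto simp: S_def Z_def E_def)
          qed
          then have "UU.prob E \<le> C x y'"
            using UU.finite_measure_mono[OF _ Z_sets, of E x y'] Z[OF x, of y'] y y' by simp
          also have "\<dots> \<le> C x y + e"
            using copula_increment_right(2)[OF cop, of x y y'] x y y' by simp
          finally show "UU.prob E \<le> C x y + e" .
        qed
      qed
    qed
    finally show ?thesis .
  qed
  moreover have "prob_space M" unfolding M_def by (rule UU.prob_space_distr[OF XY])
  ultimately have "copula_law C M" by (simp add: copula_law_def M_def)
  then show ?thesis ..
qed

section \<open>Stable tail dependence functions\<close>

text \<open>
  The stable tail dependence function \<open>\<ell>\<close> of \<open>A\<close>: the homogeneous extension of \<open>A\<close> from the simplex to
  the quadrant. It turns both copula families into \<open>\<psi> (\<ell> (\<phi> x) (\<phi> y))\<close>, with \<open>\<psi> z = exp (- z)\<close> in the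
  extreme-value case.
\<close>

definition stdf :: "(real \<Rightarrow> real) \<Rightarrow> real \<Rightarrow> real \<Rightarrow> real" where
  "stdf A u v = (u + v) * A (u / (u + v))"

lemma pickandsD:
  assumes "pickands A"
  shows "convex_on {0..1} A" "\<And>t. 0 \<le> t \<Longrightarrow> t \<le> 1 \<Longrightarrow> 1 - t \<le> A t"
    "\<And>t. 0 \<le> t \<Longrightarrow> t \<le> 1 \<Longrightarrow> t \<le> A t" "\<And>t. 0 \<le> t \<Longrightarrow> t \<le> 1 \<Longrightarrow> A t \<le> 1" "A 0 = 1" "A 1 = 1"
  using assms unfolding pickands_def by (force intro: antisym)+

lemma stdf_homogeneous: "stdf A (s * u) (s * v) = s * stdf A u v"
  by (cases "s = 0") (simp_all add: stdf_def distrib_left[symmetric])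

lemma stdf_on_simplex: "stdf A t (1 - t) = A t"
  by (simp add: stdf_def)

lemma stdf_axis:
  assumes "pickands A"
  shows "stdf A u 0 = u" "stdf A 0 v = v"
  using pickandsD(5,6)[OF assms] by (cases "u = 0"; simp add: stdf_def)+

lemma stdf_bounds:
  assumes "pickands A" "0 \<le> u" "0 \<le> v"
  shows "u \<le> stdf A u v" "v \<le> stdf A u v" "stdf A u v \<le> u + v"
proof -
  have "u \<le> stdf A u v \<and> v \<le> stdf A u v \<and> stdf A u v \<le> u + v"
  proof (cases "u + v = 0")
    case True
    then show ?thesis using assms by (simp add: stdf_def)
  next
    case False
    define t where "t = u / (u + v)"
    have t: "0 \<le> t" "t \<le> 1" using False assms by (auto simp: t_def)
    have uv: "u = (u + v) * t" "v = (u + v) * (1 - t)" using False by (auto simp: t_def field_simps)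
    have "(u + v) * t \<le> (u + v) * A t" "(u + v) * (1 - t) \<le> (u + v) * A t" "(u + v) * A t \<le> (u + v) * 1"
      using pickandsD(2-4)[OF assms(1) t] assms by (intro mult_left_mono; simp)+
    moreover have "stdf A u v = (u + v) * A t" by (simp add: stdf_def t_def)
    ultimately show ?thesis using uv by (metis mult.right_neutral)
  qed
  then show "u \<le> stdf A u v" "v \<le> stdf A u v" "stdf A u v \<le> u + v" by auto
qed

lemma stdf_pos: "pickands A \<Longrightarrow> 0 < u \<Longrightarrow> 0 < v \<Longrightarrow> 0 < stdf A u v"
  using stdf_bounds(1)[of A u v] by simp

lemma stdf_subadditive:
  assumes A: "pickands A" and nn: "0 \<le> u" "0 \<le> v" "0 \<le> u'" "0 \<le> v'"
  shows "stdf A (u + u') (v + v') \<le> stdf A u v + stdf A u' v'"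
proof (cases "u + v = 0 \<or> u' + v' = 0")
  case True
  then have "u = 0 \<and> v = 0 \<or> u' = 0 \<and> v' = 0" using nn by auto
  then show ?thesis by (auto simp: stdf_def)
next
  case False
  define a b where "a = u + v" and "b = u' + v'"
  have ab: "0 < a" "0 < b" using False nn by (auto simp: a_def b_def)
  have "A ((1 - b / (a + b)) *\<^sub>R (u / a) + (b / (a + b)) *\<^sub>R (u' / b))
      \<le> (1 - b / (a + b)) * A (u / a) + (b / (a + b)) * A (u' / b)"
    using ab nn by (intro convex_onD[OF pickandsD(1)[OF A]]) (auto simp: a_def b_def field_simps)
  also have "1 - b / (a + b) = a / (a + b)" using ab by (simp add: field_simps)
  finally have "A ((u + u') / (a + b)) \<le> a / (a + b) * A (u / a) + b / (a + b) * A (u' / b)"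
    using ab by (simp add: add_divide_distrib)
  then have "(a + b) * A ((u + u') / (a + b)) \<le> (a + b) * (a / (a + b) * A (u / a) + b / (a + b) * A (u' / b))"
    using ab by (intro mult_left_mono) auto
  also have "\<dots> = a * A (u / a) + b * A (u' / b)" using ab by (simp add: distrib_left)
  finally show ?thesis by (simp add: stdf_def a_def b_def algebra_simps)
qed

lemma stdf_convex_comb:
  assumes A: "pickands A" and nn: "0 \<le> u" "0 \<le> v" "0 \<le> u'" "0 \<le> v'" "0 \<le> a" "0 \<le> b"
  shows "stdf A (a * u + b * u') (a * v + b * v') \<le> a * stdf A u v + b * stdf A u' v'"
  using stdf_subadditive[OF A, of "a * u" "a * v" "b * u'" "b * v'"] nn
  by (simp add: stdf_homogeneous)

text \<open>
  Exchanging the two coordinates of \<open>\<ell>\<close> reflects \<open>A\<close>; this transfers statements about the second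
  argument to the first.
\<close>

lemma pickands_reflect:
  assumes "pickands A"
  shows "pickands (\<lambda>t. A (1 - t))"
  unfolding pickands_def
proof (intro conjI ballI)
  show "convex_on {0..1} (\<lambda>t. A (1 - t))"
  proof (rule convex_onI)
    fix t x y :: real
    assume *: "0 < t" "t < 1" "x \<in> {0..1}" "y \<in> {0..1}"
    have "1 - ((1 - t) *\<^sub>R x + t *\<^sub>R y) = (1 - t) *\<^sub>R (1 - x) + t *\<^sub>R (1 - y)"
      by (simp add: algebra_simps)
    then show "A (1 - ((1 - t) *\<^sub>R x + t *\<^sub>R y)) \<le> (1 - t) * A (1 - x) + t * A (1 - y)"
      using convex_onD[OF pickandsD(1)[OF assms], of t "1 - x" "1 - y"] * by simp
  qed simp
next
  fix t :: real assume "t \<in> {0..1}"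
  then show "max (1 - t) t \<le> A (1 - t)" "A (1 - t) \<le> 1"
    using pickandsD(2-4)[OF assms, of "1 - t"] by auto
qed

lemma stdf_reflect: "stdf (\<lambda>t. A (1 - t)) v u = stdf A u v"
proof (cases "u + v = 0")
  case False
  then have "1 - v / (v + u) = u / (u + v)" by (simp add: field_simps)
  then show ?thesis by (simp add: stdf_def add.commute)
qed (simp add: stdf_def add.commute)

text \<open>
  The chord of the convex function \<open>\<ell> u\<close> over \<open>[0, v']\<close> starts at the height \<open>\<ell> u 0 = u\<close>, which is also
  a lower bound of the function. Monotonicity in \<open>v\<close> follows, and it is strict wherever \<open>u < \<ell> u v\<close>.
\<close>

lemma stdf_chord_right:
  assumes A: "pickands A" and nn: "0 \<le> u" "0 \<le> v" "v \<le> v'"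
  shows "v' * stdf A u v \<le> v * stdf A u v' + (v' - v) * u"
proof (cases "v' = 0")
  case False
  then have "stdf A (v / v' * u + (1 - v / v') * u) (v / v' * v' + (1 - v / v') * 0)
      \<le> v / v' * stdf A u v' + (1 - v / v') * stdf A u 0"
    using nn by (intro stdf_convex_comb[OF A]) auto
  then have "v' * stdf A u v \<le> v' * (v / v' * stdf A u v' + (1 - v / v') * u)"
    using nn False by (intro mult_left_mono) (auto simp: stdf_axis[OF A] algebra_simps)
  then show ?thesis using False by (simp add: algebra_simps)
qed (use nn in simp)

lemma stdf_mono_right:
  assumes A: "pickands A" and nn: "0 \<le> u" "0 \<le> v" "v \<le> v'"
  shows "stdf A u v \<le> stdf A u v'"
proof (cases "v' = 0")
  case False
  have "v' * stdf A u v \<le> v * stdf A u v' + (v' - v) * u" by (rule stdf_chord_right[OF assms])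
  also have "\<dots> \<le> v * stdf A u v' + (v' - v) * stdf A u v'"
    using nn stdf_bounds(1)[OF A, of u v'] by (intro add_left_mono mult_left_mono) auto
  finally show ?thesis using False nn by (simp add: algebra_simps)
qed (use nn in simp)

lemma stdf_strict_mono_right:
  assumes A: "pickands A" and nn: "0 \<le> u" "0 \<le> v" "v < v'" and gt: "u < stdf A u v"
  shows "stdf A u v < stdf A u v'"
proof -
  have "v' * stdf A u v \<le> v * stdf A u v' + (v' - v) * u" using assms by (intro stdf_chord_right) auto
  also have "\<dots> < v * stdf A u v' + (v' - v) * stdf A u v'"
    using nn gt stdf_mono_right[OF A, of u v v'] by (intro add_strict_left_mono mult_strict_left_mono) auto
  finally show ?thesis using nn by (simp add: algebra_simps)
qed

lemma stdf_mono_left: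
  assumes A: "pickands A" and nn: "0 \<le> u" "u \<le> u'" "0 \<le> v"
  shows "stdf A u v \<le> stdf A u' v"
  using stdf_mono_right[OF pickands_reflect[OF A], of v u u'] nn by (simp add: stdf_reflect)

lemma stdf_strict_mono_left:
  assumes A: "pickands A" and nn: "0 \<le> u" "u < u'" "0 \<le> v" and gt: "v < stdf A u v"
  shows "stdf A u v < stdf A u' v"
  using stdf_strict_mono_right[OF pickands_reflect[OF A], of v u u'] nn gt by (simp add: stdf_reflect)

lemma stdf_mono:
  assumes A: "pickands A" and nn: "0 \<le> u" "u \<le> u'" "0 \<le> v" "v \<le> v'"
  shows "stdf A u v \<le> stdf A u' v'"
  using stdf_mono_left[OF A, of u u' v] stdf_mono_right[OF A, of u' v v'] nn by simp

lemma stdf_lipschitz_right: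
  assumes A: "pickands A" and nn: "0 \<le> u" "0 \<le> v" "v \<le> v'"
  shows "stdf A u v' \<le> stdf A u v + (v' - v)"
  using stdf_subadditive[OF A, of u v 0 "v' - v"] nn by (simp add: stdf_axis[OF A])

text \<open>
  Seen from the origin, both \<open>(u, v)\<close> and \<open>(u', v')\<close> lie in the cone spanned by \<open>(u', v)\<close> and \<open>(u, v')\<close>,
  with coefficients \<open>a, b\<close> and \<open>1 - a, 1 - b\<close> that lie in \<open>[0, 1]\<close>. Adding the two resulting
  inequalities of sublinearity gives the claim.
\<close>

lemma stdf_submodular:
  assumes A: "pickands A" and nn: "0 \<le> u" "u \<le> u'" "0 \<le> v" "v \<le> v'"
  shows "stdf A u v + stdf A u' v' \<le> stdf A u v' + stdf A u' v"
proof (cases "u * v < u' * v'")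
  case False
  then have "u * v = u' * v'" using mult_mono[of u u' v v'] nn by auto
  then have "u = u' \<or> v = v' \<or> (u = 0 \<and> v' = 0) \<or> (v = 0 \<and> u' = 0)"
    using nn mult_strict_mono'[of u u' v v'] by (smt (verit, best) mult_eq_0_iff)
  then show ?thesis using nn by auto
next
  case True
  define d where "d = u' * v' - u * v"
  define a b where "a = u * (v' - v) / d" and "b = v * (u' - u) / d"
  have d: "0 < d" using True by (simp add: d_def)
  have "u * v' \<le> u' * v'" "u' * v \<le> u' * v'" "u * v \<le> u * v'" "u * v \<le> u' * v"
    using nn by (auto intro: mult_mono)
  then have ab: "0 \<le> a" "a \<le> 1" "0 \<le> b" "b \<le> 1"
    using nn d by (auto simp: a_def b_def d_def field_simps)
  have comb: "a * u' + b * u = u" "a * v + b * v' = v"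
    using d by (auto simp: a_def b_def field_simps) (auto simp: d_def algebra_simps)
  then have comb': "(1 - a) * u' + (1 - b) * u = u'" "(1 - a) * v + (1 - b) * v' = v'"
    by (auto simp: algebra_simps)
  have "stdf A u v \<le> a * stdf A u' v + b * stdf A u v'"
    using stdf_convex_comb[OF A, of u' v u v' a b] ab nn by (simp add: comb)
  moreover have "stdf A u' v' \<le> (1 - a) * stdf A u' v + (1 - b) * stdf A u v'"
    using stdf_convex_comb[OF A, of u' v u v' "1 - a" "1 - b"] ab nn by (simp add: comb')
  ultimately show ?thesis by (simp add: algebra_simps)
qed

text \<open>
  If \<open>\<ell> 1 1 = 1\<close>, that is \<open>A (1/2) = 1/2\<close>, then convexity between the diagonal and the axes forces \<open>A\<close>
  down to its lower bound.
\<close>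

lemma stdf_diagonal_gt_1:
  assumes A: "pickands A" and ne: "\<exists>t\<in>{0..1}. A t \<noteq> A_M t"
  shows "1 < stdf A 1 1"
proof (rule ccontr)
  assume "\<not> 1 < stdf A 1 1"
  then have le: "stdf A 1 1 \<le> 1" by simp
  have "A t = A_M t" if t: "0 \<le> t" "t \<le> 1" for t
  proof -
    have "A t \<le> A_M t"
    proof (cases "t \<le> 1 / 2")
      case True
      then have "stdf A (t * 1 + (1 - 2 * t) * 0) (t * 1 + (1 - 2 * t) * 1) \<le> t * stdf A 1 1 + (1 - 2 * t) * stdf A 0 1"
        using t by (intro stdf_convex_comb[OF A]) auto
      also have "\<dots> \<le> t * 1 + (1 - 2 * t) * 1"
        using t le True by (intro add_mono mult_left_mono) (auto simp: stdf_axis[OF A])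
      finally show ?thesis using True stdf_on_simplex[of A t] by (simp add: A_M_def algebra_simps)
    next
      case False
      then have "stdf A ((1 - t) * 1 + (2 * t - 1) * 1) ((1 - t) * 1 + (2 * t - 1) * 0)
          \<le> (1 - t) * stdf A 1 1 + (2 * t - 1) * stdf A 1 0"
        using t by (intro stdf_convex_comb[OF A]) auto
      also have "\<dots> \<le> (1 - t) * 1 + (2 * t - 1) * 1"
        using t le False by (intro add_mono mult_left_mono) (auto simp: stdf_axis[OF A])
      finally show ?thesis using False stdf_on_simplex[of A t] by (simp add: A_M_def algebra_simps)
    qed
    then show ?thesis using pickandsD(2,3)[OF A t] by (simp add: A_M_def)
  qed
  then show False using ne by auto
qed

section \<open>Extreme-value copulas\<close>

text \<open>
  The case \<open>a + d = b + c\<close> is \<open>0 < exp (- a) (1 - exp (a - b)) (1 - exp (a - c))\<close>. With submodularity and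
  monotonicity of \<open>\<ell>\<close> it shows that \<open>exp (- \<ell>)\<close> gives nonnegative mass to rectangles, and positive
  mass wherever \<open>\<ell>\<close> is strictly increasing in both arguments.
\<close>

lemma exp_sum_less:
  fixes a b c d :: real
  assumes "a < b" "a < c" "a + d \<le> b + c"
  shows "exp (- b) + exp (- c) < exp (- a) + exp (- d)"
proof -
  have "0 < exp (- a) * ((1 - exp (a - b)) * (1 - exp (a - c)))"
    using assms by simp
  also have "\<dots> = exp (- a) + exp (a - b - c) - exp (- b) - exp (- c)"
    by (simp add: algebra_simps flip: exp_add)
  also have "exp (a - b - c) \<le> exp (- d)" using assms by simp
  finally show ?thesis by simp
qed

lemma exp_sum_le:
  fixes a b c d :: real
  assumes "a \<le> b" "a \<le> c" "a + d \<le> b + c"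
  shows "exp (- b) + exp (- c) \<le> exp (- a) + exp (- d)"
proof (cases "a < b \<and> a < c")
  case True
  then show ?thesis using exp_sum_less assms by (intro less_imp_le) auto
next
  case False
  then have "a = b \<or> a = c" using assms by auto
  then show ?thesis using assms by auto
qed

lemma ev_copula_eq_exp:
  assumes A: "pickands A" and "0 < x" "x \<le> 1" "0 < y" "y \<le> 1"
  shows "ev_copula A x y = exp (- stdf A (- ln x) (- ln y))"
proof (cases "x = 1 \<or> y = 1")
  case True
  then show ?thesis
    using assms stdf_axis[OF A] by (auto simp: ev_copula_def copula_extension_def min_absorb1)
next
  case False
  have "- ln x / (- ln x + - ln y) = ln x / (ln x + ln y)"
    using minus_divide_divide[of "ln x" "ln x + ln y"] by simp
  then show ?thesis
    using assms False
    by (simp add: ev_copula_def copula_extension_def stdf_def powr_def ln_mult algebra_simps)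
qed

lemma is_copula_ev_copula:
  assumes A: "pickands A"
  shows "is_copula (ev_copula A)"
  unfolding is_copula_def
proof (intro conjI ballI)
  fix x y x' y' :: real
  assume *: "x \<in> {0..1}" "x' \<in> {x..1}" "y \<in> {0..1}" "y' \<in> {y..1}"
  have zero: "ev_copula A x 0 = 0" "ev_copula A 0 x = 0" for x
    by (auto simp: ev_copula_def copula_extension_def)
  have nonneg: "0 \<le> ev_copula A x y" if "0 < x" "x \<le> 1" "0 < y" "y \<le> 1" for x y
    using that by (simp add: ev_copula_eq_exp[OF A])
  have mono: "ev_copula A x y \<le> ev_copula A x' y'" if "0 < x" "x \<le> x'" "x' \<le> 1" "0 < y" "y \<le> y'" "y' \<le> 1" for x x' y y'
    using that by (auto simp: ev_copula_eq_exp[OF A] intro!: stdf_mono[OF A])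
  show "ev_copula A x y' + ev_copula A x' y \<le> ev_copula A x y + ev_copula A x' y'"
  proof (cases "x = 0 \<or> y = 0")
    case True
    show ?thesis
    proof (cases "x' = 0 \<or> y' = 0")
      case True
      then show ?thesis using * \<open>x = 0 \<or> y = 0\<close> zero by auto
    next
      case False
      then show ?thesis
        using True * zero mono[of x x' y' y'] mono[of x' x' y y'] nonneg[of x' y'] 
        by (cases "x = 0"; cases "y = 0") auto
    qed
  next
    case False
    then have pos: "0 < x" "0 < y" "0 < x'" "0 < y'" using * by auto
    show ?thesis
      using * pos
        exp_sum_le[of "stdf A (- ln x') (- ln y')" "stdf A (- ln x) (- ln y')"
          "stdf A (- ln x') (- ln y)" "stdf A (- ln x) (- ln y)"]
        stdf_submodular[OF A, of "- ln x'" "- ln x" "- ln y'" "- ln y"]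
        stdf_mono[OF A, of "- ln x'" "- ln x" "- ln y'" "- ln y'"]
        stdf_mono[OF A, of "- ln x'" "- ln x'" "- ln y'" "- ln y"]
      by (simp add: ev_copula_eq_exp[OF A])
  qed
qed (auto simp: ev_copula_def copula_extension_def)

text \<open>
  The slopes of the secants ending in \<open>u\<close> increase and are bounded by any slope to the right of \<open>u\<close>,
  so they converge to their supremum.
\<close>

lemma convex_on_left_derivative:
  fixes g :: "real \<Rightarrow> real"
  assumes g: "convex_on S g" and ab: "a \<in> S" "u \<in> S" "b \<in> S" "a < u" "u < b"
  shows "\<exists>d. (g has_field_derivative d) (at u within {a..u})"
proof -
  define q where "q t = (g t - g u) / (t - u)" for t
  have S: "{a..b} \<subseteq> S"
    using ab convex_contains_segment[of S] convex_on_imp_convex[OF g]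
    by (metis closed_segment_eq_real_ivl1 less_imp_le order_less_trans)
  have q_mono: "q s \<le> q t" if "a \<le> s" "s < t" "t < u" for s t
    using convex_on_slope_le(2)[OF g, of s u t] that S ab unfolding q_def
    by (metis atLeastAtMost_iff less_imp_le order_trans subsetD minus_diff_eq minus_divide_divide)
  have q_bound: "q t \<le> (g b - g u) / (b - u)" if "a \<le> t" "t < u" for t
    using convex_on_slope_le[OF g, of t b u] that S ab unfolding q_def
    by (smt (verit) atLeastAtMost_iff minus_divide_divide subsetD)
  have bdd: "bdd_above (q ` {a..<u})" by (rule bdd_aboveI[of _ "(g b - g u) / (b - u)"]) (auto intro: q_bound)
  define d where "d = Sup (q ` {a..<u})"
  have "(q \<longlongrightarrow> d) (at u within {a..u})"
  proof (rule order_tendstoI)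
    fix e assume "e < d"
    then obtain t where t: "a \<le> t" "t < u" "e < q t"
      unfolding d_def using ab bdd by (subst (asm) less_cSup_iff) auto
    have "e < q s" if "t \<le> s" "s < u" for s
      using q_mono[of t s] t that by (cases "s = t") auto
    then show "eventually (\<lambda>s. e < q s) (at u within {a..u})"
      unfolding eventually_at by (intro exI[of _ "u - t"]) (use t in \<open>auto simp: dist_real_def\<close>)
  next
    fix e assume "d < e"
    have "q s \<le> d" if "a \<le> s" "s < u" for s
      unfolding d_def using that bdd by (intro cSup_upper) auto
    then show "eventually (\<lambda>s. q s < e) (at u within {a..u})"
      unfolding eventually_at using \<open>d < e\<close> ab by (intro exI[of _ 1]) force
  qed
  then show ?thesis unfolding has_field_derivative_iff q_def by blast
qed

lemma convex_on_stdf_left: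
  assumes "pickands A" "0 \<le> v"
  shows "convex_on {0..} (\<lambda>u. stdf A u v)"
proof (rule convex_onI)
  fix t x y :: real assume *: "0 < t" "t < 1" "x \<in> {0..}" "y \<in> {0..}"
  have "(1 - t) * v + t * v = v" by (simp add: algebra_simps)
  then show "stdf A ((1 - t) *\<^sub>R x + t *\<^sub>R y) v \<le> (1 - t) * stdf A x v + t * stdf A y v"
    using stdf_convex_comb[OF assms(1), of x v y v "1 - t" t] * assms(2) by simp
qed simp

text \<open>
  In the coordinate \<open>u = - ln x\<close> the exponent \<open>\<ell>\<close> is convex, hence has left derivatives. As \<open>- ln\<close>
  reverses the order, these yield the right derivatives in \<open>x\<close> that the construction of the law needs.
\<close>

lemma ex_ev_copula_law:
  assumes A: "pickands A"
  shows "\<exists>M. copula_law (ev_copula A) M"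
proof (rule ex_copula_law[OF is_copula_ev_copula[OF A]])
  fix x y :: real assume x: "0 < x" "x < 1" and y: "0 < y" "y < 1"
  have ln: "ln x < 0" "ln y < 0" using x y by (auto simp: ln_less_zero)
  define g where "g u = stdf A u (- ln y)" for u
  have "\<exists>d. (g has_field_derivative d) (at (- ln x) within {0..- ln x})"
    unfolding g_def
    by (rule convex_on_left_derivative[OF convex_on_stdf_left[OF A], where b = "- ln x + 1"])
      (use ln in auto)
  then obtain d where d: "(g has_field_derivative d) (at (- ln x) within {0..- ln x})" ..
  define f where "f s = exp (- g (- ln s))" for s
  have "(g \<circ> (\<lambda>s. - ln s) has_field_derivative d * (- inverse x)) (at x within {x..1})"
  proof (rule DERIV_image_chain)
    show "(g has_field_derivative d) (at (- ln x) within (\<lambda>s. - ln s) ` {x..1})"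
      by (rule has_field_derivative_subset[OF d]) (use x in auto)
    show "((\<lambda>s. - ln s) has_field_derivative - inverse x) (at x within {x..1})"
      using x by (auto intro!: derivative_eq_intros simp: field_simps)
  qed
  then have "(f has_field_derivative exp (- g (- ln x)) * - (d * (- inverse x))) (at x within {x..1})"
    unfolding f_def o_def by (intro DERIV_chain2[where f = exp] derivative_intros) 
  moreover have ev: "eventually (\<lambda>n. x + 1 / real (Suc n) \<in> {x..1}) sequentially"
    using order_tendstoD(2)[OF LIMSEQ_Suc[OF lim_1_over_n], of "1 - x"] x
    by (auto elim!: eventually_mono)
  ultimately have "(\<lambda>n. real (Suc n) * (f (x + 1 / real (Suc n)) - f x)) \<longlonglongrightarrow> exp (- g (- ln x)) * - (d * (- inverse x))"
    by (rule tendsto_right_difference_quotient)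
  moreover from ev have "eventually (\<lambda>n. real (Suc n) * (f (x + 1 / real (Suc n)) - f x)
    = real (Suc n) * (ev_copula A (x + 1 / real (Suc n)) y - ev_copula A x y)) sequentially"
  proof eventually_elim
    case (elim n)
    have "ev_copula A s y = f s" if "s \<in> {x..1}" for s
      using that x y by (simp add: f_def g_def ev_copula_eq_exp[OF A])
    then show ?case using elim x by (metis atLeastAtMost_iff less_imp_le order_refl)
  qed
  ultimately have "(\<lambda>n. real (Suc n) * (ev_copula A (x + 1 / real (Suc n)) y - ev_copula A x y))
      \<longlonglongrightarrow> exp (- g (- ln x)) * - (d * (- inverse x))"
    by (rule Lim_transform_eventually)
  then show "convergent (\<lambda>n. real (Suc n) * (ev_copula A (x + 1 / real (Suc n)) y - ev_copula A x y))"
    by (rule convergentI)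
qed

text \<open>
  Let \<open>m = stdf B u v\<close> and \<open>k \<ge> max u v\<close>. Then \<open>w powr \<theta> \<le> k powr (\<theta> - 1) * w\<close> for \<open>w = u\<close> and \<open>w = v\<close>, so by
  monotonicity and homogeneity \<open>stdf A u v powr \<theta> \<le> k powr (\<theta> - 1) * m\<close>. The choice \<open>k = m\<close> gives the first
  claim and \<open>k = max u v\<close> the second.
\<close>

lemma stdf_power_transform_less:
  assumes A: "pickands A" and B: "pickands B" and \<theta>: "1 < \<theta>" and pos: "0 < u" "0 < v"
    and eq: "stdf A u v powr \<theta> = stdf B (u powr \<theta>) (v powr \<theta>)"
  shows "stdf A u v \<le> stdf B u v"
    and "max u v < stdf B u v \<Longrightarrow> stdf A u v < stdf B u v"
proof -
  define m where "m = stdf B u v"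
  have m: "u \<le> m" "v \<le> m" "0 < m" using stdf_bounds[OF B, of u v] pos by (auto simp: m_def)
  have bound: "stdf A u v powr \<theta> \<le> k powr (\<theta> - 1) * m" if "u \<le> k" "v \<le> k" for k
  proof -
    have *: "w powr \<theta> \<le> k powr (\<theta> - 1) * w" if "0 < w" "w \<le> k" for w
    proof -
      have "w powr \<theta> = w powr (\<theta> - 1) * w"
        using that powr_add[of w "\<theta> - 1" 1] by simp
      also have "\<dots> \<le> k powr (\<theta> - 1) * w"
        using that \<theta> by (intro mult_right_mono powr_mono2) auto
      finally show ?thesis .
    qed
    have "stdf B (u powr \<theta>) (v powr \<theta>) \<le> stdf B (k powr (\<theta> - 1) * u) (k powr (\<theta> - 1) * v)"
      using * pos that by (intro stdf_mono[OF B]) auto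
    then show ?thesis unfolding eq m_def by (simp add: stdf_homogeneous)
  qed
  have mm: "m powr (\<theta> - 1) * m = m powr \<theta>" using m powr_add[of m "\<theta> - 1" 1] by simp
  have \<theta>0: "0 < \<theta>" using \<theta> by simp
  have A0: "0 \<le> stdf A u v" using stdf_pos[OF A pos] by simp
  show "stdf A u v \<le> stdf B u v"
  proof (rule ccontr)
    assume "\<not> stdf A u v \<le> stdf B u v"
    then have "m powr \<theta> < stdf A u v powr \<theta>"
      using m \<theta>0 by (intro powr_less_mono2) (auto simp: m_def)
    then show False using bound[OF m(1,2)] mm by simp
  qed
  show "stdf A u v < stdf B u v" if "max u v < stdf B u v"
  proof (rule ccontr)
    assume "\<not> stdf A u v < stdf B u v"
    then have "m powr \<theta> \<le> stdf A u v powr \<theta>"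
      using m \<theta>0 by (intro powr_mono2) (auto simp: m_def)
    also have "\<dots> \<le> max u v powr (\<theta> - 1) * m" by (rule bound) auto
    also have "\<dots> < m powr (\<theta> - 1) * m"
      using that \<theta> pos m by (intro mult_strict_right_mono powr_less_mono2) (auto simp: m_def)
    finally show False using mm by simp
  qed
qed

text \<open>
  A power transform with \<open>\<theta> > 1\<close> moves the copula strictly up in the concordance order. The rectangle
  needed for strictness is \<open>[1, c]\<^sup>2\<close> in the coordinates \<open>- ln x\<close>, \<open>- ln y\<close>, with \<open>1 < c < stdf B 1 1\<close>: there
  \<open>max u v \<le> c\<close> stays below \<open>stdf B 1 1 \<le> stdf B u v\<close>.
\<close>

lemma kendall_tau_power_transform_less:
  assumes A: "pickands A" and B: "pickands B" and ne: "\<exists>t\<in>{0..1}. B t \<noteq> A_M t" and \<theta>: "1 < \<theta>"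
    and eq: "\<And>u v. 0 < u \<Longrightarrow> 0 < v \<Longrightarrow> stdf A u v powr \<theta> = stdf B (u powr \<theta>) (v powr \<theta>)"
  shows "kendall_tau (ev_copula B) < kendall_tau (ev_copula A)"
proof -
  obtain M N where law: "copula_law (ev_copula A) M" "copula_law (ev_copula B) N"
    using ex_ev_copula_law A B by blast
  note cop = is_copula_ev_copula[OF A] is_copula_ev_copula[OF B]
  obtain c where c: "1 < c" "c < stdf B 1 1" using dense[OF stdf_diagonal_gt_1[OF B ne]] by blast
  have less: "stdf A u v < stdf B u v" if "1 \<le> u" "u \<le> c" "1 \<le> v" "v \<le> c" for u v
  proof (rule stdf_power_transform_less(2)[OF A B \<theta> _ _ eq])
    show "max u v < stdf B u v" using that c stdf_mono[OF B, of 1 u 1 v] by simp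
  qed (use that in auto)
  show ?thesis
  proof (rule kendall_tau_strict_mono[OF law(2) cop(2) law(1) cop(1),
        of "exp (- c)" "exp (- 1)" "exp (- c)" "exp (- 1)"])
    fix x y :: real assume xy: "0 \<le> x" "x \<le> 1" "0 \<le> y" "y \<le> 1"
    show "ev_copula B x y \<le> ev_copula A x y"
    proof (cases "x = 0 \<or> y = 0 \<or> x = 1 \<or> y = 1")
      case True
      then show ?thesis using xy by (auto simp: ev_copula_def copula_extension_def)
    next
      case False
      then have "stdf A (- ln x) (- ln y) \<le> stdf B (- ln x) (- ln y)"
        using xy by (intro stdf_power_transform_less(1)[OF A B \<theta> _ _ eq]) (auto simp: ln_less_zero)
      then show ?thesis using xy False by (simp add: ev_copula_eq_exp A B)
    qed
  next
    fix x y assume xy: "exp (- c) < x" "x \<le> exp (- 1)" "exp (- c) < y" "y \<le> exp (- 1)"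
    have pos: "0 < x" "0 < y" using xy by (meson exp_gt_zero less_trans)+
    have "exp (- 1) \<le> (1 :: real)" by simp
    then have le1: "x \<le> 1" "y \<le> 1" using xy by linarith+
    have "stdf A (- ln x) (- ln y) < stdf B (- ln x) (- ln y)"
    proof (rule less)
      have "ln (exp (- c)) \<le> ln x" "ln x \<le> ln (exp (- 1))" "ln (exp (- c)) \<le> ln y" "ln y \<le> ln (exp (- 1))"
        using xy pos by (simp_all only: ln_le_cancel_iff exp_gt_zero less_imp_le)
      then show "1 \<le> - ln x" "- ln x \<le> c" "1 \<le> - ln y" "- ln y \<le> c" by auto
    qed
    then show "ev_copula B x y < ev_copula A x y"
      using pos le1 by (simp add: ev_copula_eq_exp A B)
  next
    have "exp (- stdf B c 1) + exp (- stdf B 1 c) < exp (- stdf B 1 1) + exp (- stdf B c c)"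
    proof (rule exp_sum_less)
      show "stdf B 1 1 < stdf B c 1" using c by (intro stdf_strict_mono_left[OF B]) auto
      show "stdf B 1 1 < stdf B 1 c" using c by (intro stdf_strict_mono_right[OF B]) auto
      show "stdf B 1 1 + stdf B c c \<le> stdf B c 1 + stdf B 1 c"
        using stdf_submodular[OF B, of 1 c 1 c] c by simp
    qed
    then show "ev_copula B (exp (- c)) (exp (- 1)) + ev_copula B (exp (- 1)) (exp (- c))
        < ev_copula B (exp (- c)) (exp (- c)) + ev_copula B (exp (- 1)) (exp (- 1))"
      using c by (simp add: ev_copula_eq_exp B)
  qed (use c in auto)
qed

section \<open>A functional equation on a half-line\<close>

text \<open>
  A monotone function that increases by a constant \<open>\<kappa>\<close> over each step of length \<open>c\<close> differs from a linear
  function of slope \<open>\<kappa> / c\<close> by at most \<open>\<kappa>\<close>. Comparing with the interval from \<open>r - 1\<close> to \<open>r\<close> bounds \<open>\<kappa>\<close>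
  by a multiple of \<open>c\<close>, and \<open>c\<close> tends to zero.
\<close>

lemma affine_of_small_periods:
  fixes G :: "real \<Rightarrow> real"
  assumes mono: "\<And>p q. q \<in> D \<Longrightarrow> p \<le> q \<Longrightarrow> G p \<le> G q"
    and down: "\<And>p q. q \<in> D \<Longrightarrow> p \<le> q \<Longrightarrow> p \<in> D"
    and small: "\<And>\<epsilon>. 0 < \<epsilon> \<Longrightarrow> \<exists>c \<kappa>. 0 < c \<and> c < \<epsilon> \<and> (\<forall>p. p + c \<in> D \<longrightarrow> G (p + c) = G p + \<kappa>)"
    and D: "p \<in> D" "q \<in> D" "r \<in> D"
  shows "G q - G p = (q - p) * (G r - G (r - 1))"
proof -
  have main: "G q - G p = (q - p) * (G r - G (r - 1))" if "p \<le> q" "q \<in> D" for p q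
  proof -
    define T where "T = G r - G (r - 1)"
    define \<delta> where "\<delta> = \<bar>G q - G p - (q - p) * T\<bar>"
    define K where "K = 2 * T * (1 + (q - p))"
    have T: "0 \<le> T" using mono[of r "r - 1"] D by (simp add: T_def)
    then have K: "0 \<le> K" using that by (simp add: K_def)
    have bound: "\<exists>c. 0 < c \<and> c < \<epsilon> \<and> \<delta> \<le> c * K" if \<epsilon>: "0 < \<epsilon>" "\<epsilon> \<le> 1 / 2" for \<epsilon>
    proof -
      obtain c \<kappa> where c: "0 < c" "c < \<epsilon>" and per: "\<And>p. p + c \<in> D \<Longrightarrow> G (p + c) = G p + \<kappa>"
        using small[OF \<epsilon>(1)] by blast
      have iter: "G (p + real n * c) = G p + real n * \<kappa>" if "p + real n * c \<in> D" for p n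
        using that
      proof (induction n)
        case (Suc n)
        have eq: "p + real (Suc n) * c = (p + real n * c) + c" by (simp add: algebra_simps)
        with Suc.prems c have "p + real n * c \<in> D" using down[of "p + real (Suc n) * c"] by simp
        then show ?case using per[of "p + real n * c"] Suc eq by (simp add: algebra_simps)
      qed simp
      have \<kappa>: "0 \<le> \<kappa>" using mono[of r "r - c"] per[of "r - c"] D c by simp
      \<comment> \<open>Counting steps upwards from p and downwards from q keeps all points below q, hence inside the domain.\<close>
      have est: "\<bar>G q - G p - (q - p) / c * \<kappa>\<bar> \<le> \<kappa>" if "p \<le> q" "q \<in> D" for p q
      proof -
        define n where "n = nat \<lfloor>(q - p) / c\<rfloor>"
        have "0 \<le> (q - p) / c" using that c by simp
        then have n: "real n \<le> (q - p) / c" "(q - p) / c < real n + 1"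
          unfolding n_def by linarith+
        have nc: "p + real n * c \<le> q" "q - real (Suc n) * c \<le> p" using n c by (auto simp: field_simps)
        have "G p + real n * \<kappa> \<le> G q"
          using iter[of p n] down[OF that(2) nc(1)] mono[OF that(2) nc(1)] by simp
        moreover have "G q \<le> G p + real (Suc n) * \<kappa>"
          using iter[of "q - real (Suc n) * c" n] iter[of "q - real (Suc n) * c" "Suc n"]
            mono[OF down[OF that(2,1)] nc(2)] that by simp
        moreover have "real n * \<kappa> \<le> (q - p) / c * \<kappa>" "(q - p) / c * \<kappa> \<le> real (Suc n) * \<kappa>"
          using n \<kappa> by (intro mult_right_mono; simp)+
        ultimately show ?thesis by (simp add: algebra_simps)
      qed
      have est_T: "\<bar>T - \<kappa> / c\<bar> \<le> \<kappa>" using est[of "r - 1" r] D by (simp add: T_def)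
      then have "\<kappa> / c \<le> T + \<kappa>" by linarith
      then have "\<kappa> \<le> c * T + c * \<kappa>" using c by (simp add: field_simps)
      moreover have "c * \<kappa> \<le> 1 / 2 * \<kappa>" using c \<epsilon> \<kappa> by (intro mult_right_mono) auto
      ultimately have \<kappa>_le: "\<kappa> \<le> 2 * c * T" by simp
      have scaled: "\<bar>(q - p) * (\<kappa> / c - T)\<bar> \<le> (q - p) * \<kappa>"
        unfolding abs_mult using \<open>p \<le> q\<close> est_T by (intro mult_mono) (auto simp: abs_minus_commute)
      have "G q - G p - (q - p) * T = (G q - G p - (q - p) / c * \<kappa>) + (q - p) * (\<kappa> / c - T)"
        by (simp add: algebra_simps)
      then have "\<delta> \<le> \<bar>G q - G p - (q - p) / c * \<kappa>\<bar> + \<bar>(q - p) * (\<kappa> / c - T)\<bar>"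
        unfolding \<delta>_def by (simp only: abs_triangle_ineq)
      also have "\<dots> \<le> \<kappa> + (q - p) * \<kappa>"
        by (rule add_mono[OF est[OF \<open>p \<le> q\<close> \<open>q \<in> D\<close>] scaled])
      also have "\<dots> = \<kappa> * (1 + (q - p))" by (simp add: algebra_simps)
      also have "\<dots> \<le> 2 * c * T * (1 + (q - p))"
        using \<kappa>_le \<open>p \<le> q\<close> by (intro mult_right_mono) auto
      finally show ?thesis using c by (intro exI[of _ c]) (simp add: K_def algebra_simps)
    qed
    have "\<delta> \<le> 0"
    proof (rule ccontr)
      assume "\<not> \<delta> \<le> 0"
      then have \<delta>: "0 < \<delta>" by simp
      define \<epsilon> where "\<epsilon> = min (1 / 2) (\<delta> / (K + 1))"
      have "0 < \<epsilon>" "\<epsilon> \<le> 1 / 2" using \<delta> K by (auto simp: \<epsilon>_def min_def)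
      then obtain c where c: "0 < c" "c < \<epsilon>" "\<delta> \<le> c * K" using bound by blast
      have "c * K \<le> \<delta> / (K + 1) * K" using c K by (intro mult_right_mono) (auto simp: \<epsilon>_def)
      also have "\<dots> < \<delta>" using \<delta> K by (simp add: field_simps)
      finally show False using c by simp
    qed
    then show ?thesis by (simp add: \<delta>_def T_def)
  qed
  show ?thesis
  proof (cases "p \<le> q")
    case False
    then show ?thesis using main[of q p] D by (simp add: algebra_simps)
  qed (use main D in blast)
qed

lemma additive_subgroup_least_positive:
  fixes \<Gamma> :: "real set"
  assumes diff: "\<And>a b. a \<in> \<Gamma> \<Longrightarrow> b \<in> \<Gamma> \<Longrightarrow> a - b \<in> \<Gamma>"
    and pos: "c \<in> \<Gamma>" "0 < c"
    and gap: "0 < \<epsilon>" "\<And>a. a \<in> \<Gamma> \<Longrightarrow> 0 < a \<Longrightarrow> \<epsilon> \<le> a"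
  obtains \<gamma> where "\<gamma> \<in> \<Gamma>" "0 < \<gamma>" "\<And>a. a \<in> \<Gamma> \<Longrightarrow> 0 < a \<Longrightarrow> \<gamma> \<le> a"
proof -
  define P where "P = {a \<in> \<Gamma>. 0 < a}"
  have P: "P \<noteq> {}" "bdd_below P" using pos by (auto simp: P_def intro: bdd_belowI[of _ 0])
  have low: "Inf P \<le> a" if "a \<in> P" for a using that P(2) by (rule cInf_lower)
  have "Inf P < Inf P + \<epsilon>" using gap by simp
  then obtain a where a: "a \<in> P" "a < Inf P + \<epsilon>" using cInf_lessD[OF P(1)] by blast
  have least: "a \<le> b" if "b \<in> P" for b
  proof (rule ccontr)
    assume "\<not> a \<le> b"
    then have "a - b \<in> \<Gamma>" "0 < a - b" using a that diff by (auto simp: P_def)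
    then have "\<epsilon> \<le> a - b" by (rule gap)
    then show False using a low[OF that] by simp
  qed
  show thesis by (rule that[of a]) (use a least in \<open>auto simp: P_def\<close>)
qed

text \<open>
  Otherwise \<open>\<Gamma>\<close> has a least positive element \<open>\<gamma>\<close>. Along \<open>0, - \<gamma>, - 2 \<gamma>, \<dots>\<close> the values of \<open>f\<close> lie in \<open>\<Gamma>\<close>,
  start at \<open>f 0 \<ge> \<gamma>\<close> and end below \<open>\<gamma>\<close>, hence at zero. At the first zero, \<open>exp (f d)\<close> drops by
  at least \<open>exp \<gamma> - 1\<close>, while \<open>exp d\<close> drops by strictly less since \<open>d < 0\<close> there; this
  contradicts the slope bound.
\<close>

lemma small_periods:
  fixes f :: "real \<Rightarrow> real"
  assumes diff: "\<And>a b. a \<in> \<Gamma> \<Longrightarrow> b \<in> \<Gamma> \<Longrightarrow> a - b \<in> \<Gamma>" and zero: "0 \<in> \<Gamma>"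
    and closed: "\<And>c. c \<in> \<Gamma> \<Longrightarrow> f c \<in> \<Gamma>"
    and f0: "0 < f 0" and nonneg: "\<And>d. 0 \<le> f d"
    and lim: "(f \<longlongrightarrow> 0) at_bot"
    and slope: "\<And>d d'. d \<le> d' \<Longrightarrow> exp (f d') - exp (f d) \<le> exp d' - exp d"
    and \<epsilon>: "0 < \<epsilon>"
  shows "\<exists>c\<in>\<Gamma>. 0 < c \<and> c < \<epsilon>"
proof (rule ccontr)
  assume "\<not> ?thesis"
  then have gap: "\<epsilon> \<le> a" if "a \<in> \<Gamma>" "0 < a" for a using that by force
  obtain \<gamma> where \<gamma>: "\<gamma> \<in> \<Gamma>" "0 < \<gamma>" and least: "\<And>a. a \<in> \<Gamma> \<Longrightarrow> 0 < a \<Longrightarrow> \<gamma> \<le> a"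
    using additive_subgroup_least_positive[OF diff closed[OF zero] f0 \<epsilon> gap] by blast
  have mult: "- (real m * \<gamma>) \<in> \<Gamma>" for m
  proof (induction m)
    case (Suc m)
    have "- (real (Suc m) * \<gamma>) = - (real m * \<gamma>) - \<gamma>" by (simp add: algebra_simps)
    then show ?case using diff[OF Suc \<gamma>(1)] by simp
  qed (simp add: zero)
  obtain N where N: "\<And>d. d \<le> N \<Longrightarrow> f d < \<gamma>"
    using order_tendstoD(2)[OF lim \<gamma>(2)] unfolding eventually_at_bot_linorder by blast
  obtain m where "- N / \<gamma> \<le> real m" using real_arch_simple by blast
  then have "f (- (real m * \<gamma>)) < \<gamma>" using \<gamma> by (intro N) (simp add: field_simps)
  then have ex: "\<exists>m. f (- (real m * \<gamma>)) < \<gamma>" by blast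
  define m where "m = (LEAST m. f (- (real m * \<gamma>)) < \<gamma>)"
  have m: "f (- (real m * \<gamma>)) < \<gamma>" unfolding m_def by (rule LeastI_ex[OF ex])
  then have fm: "f (- (real m * \<gamma>)) = 0"
    using least[OF closed[OF mult[of m]]] nonneg[of "- (real m * \<gamma>)"] by linarith
  have "m \<noteq> 0" using m least[OF closed[OF zero] f0] by (intro notI) simp
  then obtain k where k: "m = Suc k" using not0_implies_Suc by blast
  then have "\<gamma> \<le> f (- (real k * \<gamma>))"
    using not_less_Least[of k "\<lambda>m. f (- (real m * \<gamma>)) < \<gamma>"] by (simp add: m_def)
  then have "exp \<gamma> - 1 \<le> exp (f (- (real k * \<gamma>))) - exp (f (- (real m * \<gamma>)))"
    by (simp add: fm)
  also have "\<dots> \<le> exp (- (real k * \<gamma>)) - exp (- (real m * \<gamma>))"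
    using \<gamma> by (intro slope) (simp add: k)
  also have "\<dots> = exp (- (real m * \<gamma>)) * (exp \<gamma> - 1)"
    by (simp add: k algebra_simps flip: exp_add)
  also have "\<dots> < 1 * (exp \<gamma> - 1)"
    using \<gamma> k by (intro mult_strict_right_mono) auto
  finally show False by simp
qed

text \<open>
  Call \<open>c\<close> a period if \<open>G (p + c) - G p\<close> is constant in \<open>p\<close>. The periods form a group, and if \<open>c\<close> is a
  period with increment \<open>\<kappa>\<close>, then the functional equation at \<open>q = p + c\<close> shows that \<open>f c\<close> is a period
  with increment \<open>f' \<kappa>\<close>. So there are arbitrarily small periods. As \<open>D\<close> is only closed downwards,
  differences of periods are formed in the order that stays inside \<open>D\<close>.
\<close>

lemma affine_of_functional_equation:
  fixes G f f' :: "real \<Rightarrow> real"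
  assumes mono: "\<And>p q. q \<in> D \<Longrightarrow> p \<le> q \<Longrightarrow> G p \<le> G q"
    and down: "\<And>p q. q \<in> D \<Longrightarrow> p \<le> q \<Longrightarrow> p \<in> D"
    and eq: "\<And>p q. p + f (q - p) \<in> D \<Longrightarrow> G (p + f (q - p)) = G p + f' (G q - G p)"
    and f0: "0 < f 0" and nonneg: "\<And>d. 0 \<le> f d" and ge: "\<And>d. d \<le> f d"
    and lim: "(f \<longlongrightarrow> 0) at_bot"
    and slope: "\<And>d d'. d \<le> d' \<Longrightarrow> exp (f d') - exp (f d) \<le> exp d' - exp d"
    and D: "p \<in> D" "q \<in> D" "r \<in> D"
  shows "G q - G p = (q - p) * (G r - G (r - 1))"
proof (rule affine_of_small_periods[OF mono down _ D])
  fix \<epsilon> :: real assume "0 < \<epsilon>"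
  define \<Gamma> where "\<Gamma> = {c. \<exists>\<kappa>. \<forall>p\<in>D. p + c \<in> D \<longrightarrow> G (p + c) = G p + \<kappa>}"
  have "\<exists>c\<in>\<Gamma>. 0 < c \<and> c < \<epsilon>"
  proof (rule small_periods[OF _ _ _ f0 nonneg lim slope \<open>0 < \<epsilon>\<close>])
    show "0 \<in> \<Gamma>" by (auto simp: \<Gamma>_def)
    show "f c \<in> \<Gamma>" if c: "c \<in> \<Gamma>" for c
    proof -
      obtain \<kappa> where \<kappa>: "\<And>p. p \<in> D \<Longrightarrow> p + c \<in> D \<Longrightarrow> G (p + c) = G p + \<kappa>"
        using c by (auto simp: \<Gamma>_def)
      have "G (p + f c) = G p + f' \<kappa>" if "p \<in> D" "p + f c \<in> D" for p
        using eq[of p "p + c"] \<kappa>[OF that(1) down[OF that(2)]] that ge[of c] by simp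
      then show ?thesis by (auto simp: \<Gamma>_def)
    qed
    show "a - b \<in> \<Gamma>" if a: "a \<in> \<Gamma>" and b: "b \<in> \<Gamma>" for a b
    proof -
      obtain \<kappa> where \<kappa>: "\<And>p. p \<in> D \<Longrightarrow> p + a \<in> D \<Longrightarrow> G (p + a) = G p + \<kappa>"
        using a by (auto simp: \<Gamma>_def)
      obtain \<kappa>' where \<kappa>': "\<And>p. p \<in> D \<Longrightarrow> p + b \<in> D \<Longrightarrow> G (p + b) = G p + \<kappa>'"
        using b by (auto simp: \<Gamma>_def)
      have "G (p + (a - b)) = G p + (\<kappa> - \<kappa>')" if p: "p \<in> D" "p + (a - b) \<in> D" for p
      proof (cases "a \<le> 0 \<or> 0 \<le> b")
        case True
        then consider "0 \<le> b" | "a \<le> 0" by blast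
        then show ?thesis
        proof cases
          case 1
          then have "p - b \<in> D" using down[OF p(1)] by simp
          then show ?thesis using \<kappa>'[of "p - b"] \<kappa>[of "p - b"] p by (simp add: algebra_simps)
        next
          case 2
          then have "p + a \<in> D" using down[OF p(1)] by simp
          then show ?thesis using \<kappa>[of p] \<kappa>'[of "p + (a - b)"] p by (simp add: algebra_simps)
        qed
      next
        case False
        then have "p + a \<in> D" using down[OF p(2)] by simp
        then show ?thesis using \<kappa>[of p] \<kappa>'[of "p + (a - b)"] p by (simp add: algebra_simps)
      qed
      then show ?thesis by (auto simp: \<Gamma>_def)
    qed
  qed
  then obtain c \<kappa> where "0 < c" "c < \<epsilon>" "\<forall>p\<in>D. p + c \<in> D \<longrightarrow> G (p + c) = G p + \<kappa>"
    by (auto simp: \<Gamma>_def)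
  then show "\<exists>c \<kappa>. 0 < c \<and> c < \<epsilon> \<and> (\<forall>p. p + c \<in> D \<longrightarrow> G (p + c) = G p + \<kappa>)"
    using down by (metis less_add_same_cancel1 less_imp_le)
qed

section \<open>Archimedean generators and Archimax copulas\<close>

lemma archimedean_generatorD:
  assumes "archimedean_generator \<psi>"
  shows "\<And>z. 0 \<le> z \<Longrightarrow> 0 \<le> \<psi> z" "\<And>z. 0 \<le> z \<Longrightarrow> \<psi> z \<le> 1" "continuous_on {0..} \<psi>"
    "\<And>w z. 0 \<le> w \<Longrightarrow> w \<le> z \<Longrightarrow> \<psi> z \<le> \<psi> w" "convex_on {0..} \<psi>" "\<psi> 0 = 1" "(\<psi> \<longlongrightarrow> 0) at_top" "\<psi> 1 = 1 / 2"
  using assms unfolding archimedean_generator_def by (auto simp: monotone_on_def)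

text \<open>
  If \<open>\<psi>\<close> took the same positive value at two points, convexity would keep it above that value from there
  on, contradicting the limit zero.
\<close>

lemma generator_strict_antimono:
  assumes gen: "archimedean_generator \<psi>" and w: "0 \<le> w" "w < z" and pos: "0 < \<psi> w"
  shows "\<psi> z < \<psi> w"
proof (rule ccontr)
  assume "\<not> \<psi> z < \<psi> w"
  then have eq: "\<psi> z = \<psi> w" using archimedean_generatorD(4)[OF gen, of w z] w by simp
  have "eventually (\<lambda>x. \<psi> x < \<psi> w \<and> z < x) at_top"
    using order_tendstoD(2)[OF archimedean_generatorD(7)[OF gen] pos] eventually_gt_at_top
    by (rule eventually_conj)
  then obtain x where x: "\<psi> x < \<psi> w" "z < x"
    unfolding eventually_at_top_linorder by blast
  define t where "t = (z - w) / (x - w)"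
  have t: "0 < t" "t < 1" using w x by (auto simp: t_def)
  have "(1 - t) *\<^sub>R w + t *\<^sub>R x = w + t * (x - w)" by (simp add: algebra_simps)
  also have "\<dots> = z" using w x by (simp add: t_def)
  finally have "\<psi> z \<le> (1 - t) * \<psi> w + t * \<psi> x"
    using convex_onD[OF archimedean_generatorD(5)[OF gen], of t w x] t w x by simp
  also have "\<dots> < (1 - t) * \<psi> w + t * \<psi> w" using t x by (intro add_strict_left_mono mult_strict_left_mono) auto
  finally show False using eq by (simp add: algebra_simps)
qed

lemma generator_inj:
  assumes gen: "archimedean_generator \<psi>" and "0 \<le> w" "0 \<le> z" "\<psi> w = \<psi> z" "0 < \<psi> z"
  shows "w = z"
  using generator_strict_antimono[OF gen, of w z] generator_strict_antimono[OF gen, of z w] assms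
  by (cases w z rule: linorder_cases) auto

lemma generator_surj:
  assumes gen: "archimedean_generator \<psi>" and y: "0 < y" "y < 1"
  obtains z where "0 < z" "\<psi> z = y"
proof -
  obtain b where b: "\<And>x. b \<le> x \<Longrightarrow> \<psi> x < y"
    using order_tendstoD(2)[OF archimedean_generatorD(7)[OF gen] y(1)]
    unfolding eventually_at_top_linorder by blast
  obtain z where z: "0 \<le> z" "\<psi> z = y"
    using IVT2'[of \<psi> "max b 0" y 0] b[of "max b 0"] y archimedean_generatorD(6)[OF gen]
      continuous_on_subset[OF archimedean_generatorD(3)[OF gen], of "{0..max b 0}"]
    by (auto simp: less_imp_le)
  then have "z \<noteq> 0" using archimedean_generatorD(6)[OF gen] y by auto
  then show thesis using that[of z] z by simp
qed

lemma pseudo_inverse_generator: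
  assumes gen: "archimedean_generator \<psi>" and z: "0 \<le> z" "0 < \<psi> z"
  shows "enn2real (pseudo_inverse \<psi> (\<psi> z)) = z"
proof -
  have "{w. (if w = \<infinity> then 0 else \<psi> (enn2real w)) = \<psi> z} = {ennreal z}"
  proof (intro set_eqI iffI)
    fix w assume w: "w \<in> {w. (if w = \<infinity> then 0 else \<psi> (enn2real w)) = \<psi> z}"
    then have "w \<noteq> \<infinity>" using z by auto
    then have "\<psi> (enn2real w) = \<psi> z" using w by simp
    then have "enn2real w = z" using generator_inj[OF gen _ z(1) _ z(2)] by simp
    then show "w \<in> {ennreal z}" using \<open>w \<noteq> \<infinity>\<close> by (auto simp: less_top)
  qed (use z in auto)
  then show ?thesis using z by (simp add: pseudo_inverse_def)
qed

lemma archimax_copula_generator: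
  assumes gen: "archimedean_generator \<psi>" and u: "0 < u" "0 < \<psi> u" and v: "0 < v" "0 < \<psi> v"
  shows "archimax_copula \<psi> A (\<psi> u) (\<psi> v) = \<psi> (stdf A u v)"
proof -
  have "\<psi> u < 1" "\<psi> v < 1"
    using generator_strict_antimono[OF gen, of 0] archimedean_generatorD(6)[OF gen] u v by auto
  then show ?thesis
    using u v
    by (simp add: archimax_copula_def copula_extension_def stdf_def pseudo_inverse_generator[OF gen])
qed

text \<open>
  The section \<open>\<ell> 1\<close> in logarithmic coordinates, with the properties that the functional equation
  requires. They rest on \<open>max 1 s \<le> \<ell> 1 s \<le> 1 + s\<close> and on \<open>\<ell> 1\<close> being Lipschitz with constant one.
\<close>

lemma ln_stdf_properties:
  assumes A: "pickands A"
  defines "f \<equiv> \<lambda>d. ln (stdf A 1 (exp d))"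
  shows "\<And>d. 0 \<le> f d" "\<And>d. d \<le> f d" "(f \<longlongrightarrow> 0) at_bot"
    "\<And>d d'. d \<le> d' \<Longrightarrow> exp (f d') - exp (f d) \<le> exp d' - exp d"
proof -
  have b: "1 \<le> stdf A 1 (exp d)" "exp d \<le> stdf A 1 (exp d)" "stdf A 1 (exp d) \<le> 1 + exp d" for d
    using stdf_bounds[OF A, of 1 "exp d"] by auto
  have pos: "0 < stdf A 1 (exp d)" for d using b(1)[of d] by linarith
  show nonneg: "0 \<le> f d" for d unfolding f_def using b(1)[of d] by simp
  show "d \<le> f d" for d
    unfolding f_def using b(2)[of d] pos[of d] by (simp add: ln_ge_iff)
  have "f d \<le> exp d" for d
    unfolding f_def using ln_le_minus_one[OF pos[of d]] b(3)[of d] by linarith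
  then show "(f \<longlongrightarrow> 0) at_bot"
    using nonneg by (intro tendsto_sandwich[OF _ _ tendsto_const exp_at_bot]) auto
  show "exp (f d') - exp (f d) \<le> exp d' - exp d" if "d \<le> d'" for d d'
    using stdf_lipschitz_right[OF A, of 1 "exp d" "exp d'"] that pos by (simp add: f_def)
qed

text \<open>
  Let \<open>g\<close> map \<open>u\<close> to the point where \<open>\<phi>\<close> takes the value \<open>\<psi> u\<close>. Equality of the copulas says
  \<open>g (stdf A u v) = stdf B (g u) (g v)\<close> as long as \<open>\<psi> (stdf A u v) > 0\<close>. In logarithmic coordinates, where \<open>g\<close>
  becomes \<open>G\<close>, homogeneity turns this into \<open>G (p + f (q - p)) = G p + f' (G q - G p)\<close>. So \<open>G\<close> is affine, and
  it is linear because \<open>\<psi> 1 = \<phi> 1\<close> gives \<open>G 0 = 0\<close>.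
\<close>

lemma archimax_copula_eq_imp_power_transform:
  assumes gen: "archimedean_generator \<psi>" "archimedean_generator \<phi>"
    and A: "pickands A" "\<exists>t\<in>{0..1}. A t \<noteq> A_M t" and B: "pickands B"
    and eq: "\<forall>x\<in>{0..1}. \<forall>y\<in>{0..1}. archimax_copula \<psi> A x y = archimax_copula \<phi> B x y"
  obtains \<theta> where "0 < \<theta>"
    "\<And>u. 0 < u \<Longrightarrow> 0 < \<psi> u \<Longrightarrow> \<phi> (u powr \<theta>) = \<psi> u"
    "\<And>u v. 0 < u \<Longrightarrow> 0 < v \<Longrightarrow> stdf A u v powr \<theta> = stdf B (u powr \<theta>) (v powr \<theta>)"
proof -
  \<comment> \<open>A generator may vanish from some point on, so the equation is only available on a half-line.\<close>
  define D where "D = {p. 0 < \<psi> (exp p)}"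
  have down: "p \<in> D" if "q \<in> D" "p \<le> q" for p q
    using that archimedean_generatorD(4)[OF gen(1), of "exp p" "exp q"] by (simp add: D_def)
  have \<psi>_less_1: "\<psi> u < 1" if "0 < u" for u
    using generator_strict_antimono[OF gen(1), of 0 u] archimedean_generatorD(6)[OF gen(1)] that by simp
  have "\<exists>z>0. \<phi> z = \<psi> (exp p)" if "p \<in> D" for p
    using generator_surj[OF gen(2), of "\<psi> (exp p)"] that \<psi>_less_1[of "exp p"] by (auto simp: D_def)
  then obtain g where g: "\<And>p. p \<in> D \<Longrightarrow> 0 < g p \<and> \<phi> (g p) = \<psi> (exp p)" by metis
  define G where "G p = ln (g p)" for p
  have G: "\<phi> (exp (G p)) = \<psi> (exp p)" if "p \<in> D" for p using g[OF that] by (simp add: G_def)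
  have G_unique: "G p = w" if "p \<in> D" "\<phi> (exp w) = \<psi> (exp p)" for p w
    using generator_inj[OF gen(2), of "exp (G p)" "exp w"] G[OF that(1)] that by (simp add: D_def)
  have strict: "G p < G q" if "q \<in> D" "p < q" for p q
  proof (rule ccontr)
    assume "\<not> G p < G q"
    then have "\<phi> (exp (G p)) \<le> \<phi> (exp (G q))" by (intro archimedean_generatorD(4)[OF gen(2)]) auto
    moreover have "p \<in> D" using down that by simp
    ultimately show False
      using generator_strict_antimono[OF gen(1), of "exp p" "exp q"] that G by (simp add: D_def)
  qed
  have zero: "0 \<in> D" using archimedean_generatorD(8)[OF gen(1)] by (simp add: D_def)
  have G0: "G 0 = 0"
    using archimedean_generatorD(8)[OF gen(1)] archimedean_generatorD(8)[OF gen(2)]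
    by (intro G_unique zero) simp
  have stdf_exp: "stdf C (exp p) (exp q) = exp (p + ln (stdf C 1 (exp (q - p))))" if "pickands C" for C p q
    using stdf_homogeneous[of C "exp p" 1 "exp (q - p)"] stdf_pos[OF that, of 1 "exp (q - p)"]
    by (simp add: exp_add exp_diff)
  define f where "f d = ln (stdf A 1 (exp d))" for d
  define f' where "f' d = ln (stdf B 1 (exp d))" for d
  note f = ln_stdf_properties[OF A(1), folded f_def]
  have functional: "G (p + f (q - p)) = G p + f' (G q - G p)" if r: "p + f (q - p) \<in> D" for p q
  proof (rule G_unique[OF r])
    have p: "p \<in> D" and q: "q \<in> D"
      using down[OF r] f(1)[of "q - p"] f(2)[of "q - p"] by auto
    have "\<phi> (exp (G p + f' (G q - G p))) = \<phi> (stdf B (exp (G p)) (exp (G q)))"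
      by (simp add: stdf_exp[OF B] f'_def)
    also have "\<dots> = archimax_copula \<phi> B (\<phi> (exp (G p))) (\<phi> (exp (G q)))"
      using p q G by (subst archimax_copula_generator[OF gen(2)]) (auto simp: D_def)
    also have "\<dots> = archimax_copula \<psi> A (\<psi> (exp p)) (\<psi> (exp q))"
      using eq p q G archimedean_generatorD(1,2)[OF gen(1)] by simp
    also have "\<dots> = \<psi> (stdf A (exp p) (exp q))"
      using p q by (subst archimax_copula_generator[OF gen(1)]) (auto simp: D_def)
    finally show "\<phi> (exp (G p + f' (G q - G p))) = \<psi> (exp (p + f (q - p)))"
      by (simp add: stdf_exp[OF A(1)] f_def)
  qed
  define \<theta> where "\<theta> = G 0 - G (0 - 1)"
  have \<theta>: "0 < \<theta>" using strict[OF zero, of "-1"] by (simp add: \<theta>_def)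
  have affine: "G p = \<theta> * p" if "p \<in> D" for p
  proof -
    have "G p - G 0 = (p - 0) * (G 0 - G (0 - 1))"
    proof (rule affine_of_functional_equation[where f = f and f' = f', OF _ down functional _ f(1,2,3,4) zero that zero])
      show "G p \<le> G q" if "q \<in> D" "p \<le> q" for p q using strict[of q p] that by (cases "p = q") auto
      show "0 < f 0" using stdf_diagonal_gt_1[OF A] by (simp add: f_def)
    qed
    then show ?thesis by (simp add: G0 \<theta>_def)
  qed
  show thesis
  proof (rule that[OF \<theta>])
    show "\<phi> (u powr \<theta>) = \<psi> u" if "0 < u" "0 < \<psi> u" for u
      using G[of "ln u"] affine[of "ln u"] that by (simp add: D_def powr_def mult.commute)
    show "stdf A u v powr \<theta> = stdf B (u powr \<theta>) (v powr \<theta>)" if uv: "0 < u" "0 < v" for u v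
    proof -
      \<comment> \<open>Rescaling to stdf A u v = 1 moves both arguments into the domain where the functional equation holds.\<close>
      define m where "m = stdf A u v"
      have m: "0 < m" unfolding m_def by (rule stdf_pos[OF A(1) uv])
      define p q where "p = ln (u / m)" and "q = ln (v / m)"
      have pq: "exp p = u / m" "exp q = v / m" using uv m by (auto simp: p_def q_def)
      have "stdf A (exp p) (exp q) = 1"
        using stdf_homogeneous[of A "1 / m" u v] m by (simp add: pq m_def)
      then have one: "p + f (q - p) = 0" using stdf_exp[OF A(1), of p q] by (simp add: f_def)
      have p: "p \<in> D" and q: "q \<in> D"
        using down[OF zero] one f(1)[of "q - p"] f(2)[of "q - p"] by auto
      have exp_G: "exp (G p) = (1 / m) powr \<theta> * u powr \<theta>" "exp (G q) = (1 / m) powr \<theta> * v powr \<theta>"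
        using affine p q uv m by (auto simp: powr_def p_def q_def ln_div algebra_simps simp flip: exp_add)
      have "G p + f' (G q - G p) = 0" using functional[of p q] one zero G0 by simp
      then have "stdf B (exp (G p)) (exp (G q)) = 1" using stdf_exp[OF B, of "G p" "G q"] by (simp add: f'_def)
      then have "(1 / m) powr \<theta> * stdf B (u powr \<theta>) (v powr \<theta>) = 1"
        by (simp add: exp_G stdf_homogeneous)
      then show ?thesis using m uv unfolding m_def[symmetric] by (simp add: powr_divide field_simps)
    qed
  qed
qed

lemma ev_copula_cong:
  assumes "\<And>t. 0 \<le> t \<Longrightarrow> t \<le> 1 \<Longrightarrow> A t = B t"
  shows "ev_copula A = ev_copula B"
proof (intro ext)
  fix x y
  have "A (ln x / ln (x * y)) = B (ln x / ln (x * y))" if "0 < x" "x < 1" "0 < y" "y < 1"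
  proof (rule assms)
    have neg: "ln x < 0" "ln y < 0" using that by (auto simp: ln_less_zero)
    then have "ln x + ln y < 0" by simp
    with neg show "0 \<le> ln x / ln (x * y)" "ln x / ln (x * y) \<le> 1"
      using that by (simp_all add: ln_mult divide_nonpos_neg neg_divide_le_eq)
  qed
  then show "ev_copula A x y = ev_copula B x y"
    by (simp add: ev_copula_def copula_extension_def)
qed

theorem corollary3:
  fixes \<psi>1 \<psi>2 A1 A2 :: "real \<Rightarrow> real"
  assumes "archimedean_generator \<psi>1" and "archimedean_generator \<psi>2"
    and "pickands A1" and "\<exists>t\<in>{0..1}. A1 t \<noteq> A_M t"
    and "pickands A2" and "\<exists>t\<in>{0..1}. A2 t \<noteq> A_M t"
    and "\<forall>x\<in>{0..1}. \<forall>y\<in>{0..1}. archimax_copula \<psi>1 A1 x y = archimax_copula \<psi>2 A2 x y"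
  shows "(\<forall>z\<ge>0. \<psi>1 z = \<psi>2 z) \<and> (\<forall>t\<in>{0..1}. A1 t = A2 t)
    \<longleftrightarrow> kendall_tau (ev_copula A1) = kendall_tau (ev_copula A2)"
proof
  assume "(\<forall>z\<ge>0. \<psi>1 z = \<psi>2 z) \<and> (\<forall>t\<in>{0..1}. A1 t = A2 t)"
  then have "ev_copula A1 = ev_copula A2" by (intro ev_copula_cong) auto
  then show "kendall_tau (ev_copula A1) = kendall_tau (ev_copula A2)" by simp
next
  assume tau: "kendall_tau (ev_copula A1) = kendall_tau (ev_copula A2)"
  obtain \<theta> where \<theta>: "0 < \<theta>"
    and gen: "\<And>u. 0 < u \<Longrightarrow> 0 < \<psi>1 u \<Longrightarrow> \<psi>2 (u powr \<theta>) = \<psi>1 u"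
    and tail: "\<And>u v. 0 < u \<Longrightarrow> 0 < v \<Longrightarrow> stdf A1 u v powr \<theta> = stdf A2 (u powr \<theta>) (v powr \<theta>)"
    using archimax_copula_eq_imp_power_transform[OF assms(1-5,7)] by blast
  \<comment> \<open>The inverse transform has exponent 1 / \<theta>, so one of the two exponents exceeds 1 unless \<theta> = 1.\<close>
  have tail': "stdf A2 u v powr (1 / \<theta>) = stdf A1 (u powr (1 / \<theta>)) (v powr (1 / \<theta>))"
    if uv: "0 < u" "0 < v" for u v
  proof -
    have "stdf A2 u v = stdf A1 (u powr (1 / \<theta>)) (v powr (1 / \<theta>)) powr \<theta>"
      using tail[of "u powr (1 / \<theta>)" "v powr (1 / \<theta>)"] uv \<theta> by (simp add: powr_powr)
    then show ?thesis
      using stdf_pos[OF assms(3), of "u powr (1 / \<theta>)" "v powr (1 / \<theta>)"] uv \<theta> by (simp add: powr_powr)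
  qed
  have "\<theta> = 1"
  proof (cases \<theta> "1 :: real" rule: linorder_cases)
    case less
    then show ?thesis
      using kendall_tau_power_transform_less[OF assms(5,3,4) _ tail'] \<theta> tau by simp
  next
    case greater
    then show ?thesis
      using kendall_tau_power_transform_less[OF assms(3,5,6) _ tail] tau by simp
  qed
  have "\<psi>1 z = \<psi>2 z" if z: "0 \<le> z" for z
  proof (cases "z = 0")
    case True
    then show ?thesis using archimedean_generatorD(6)[OF assms(1)] archimedean_generatorD(6)[OF assms(2)] by simp
  next
    case False
    then have "0 < z" using z by simp
    have eq: "\<psi>2 u = \<psi>1 u" if "0 < u" "0 < \<psi>1 u" for u
      using gen[OF that] \<open>\<theta> = 1\<close> that by simp
    show ?thesis
    proof (cases "0 < \<psi>1 z \<or> \<psi>2 z = 0")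
      case True
      then show ?thesis using eq[of z] archimedean_generatorD(1)[OF assms(1) z] \<open>0 < z\<close> by fastforce
    next
      case False
      then have pos: "0 < \<psi>2 z" using archimedean_generatorD(1)[OF assms(2) z] by simp
      moreover have "\<psi>2 z < 1"
        using generator_strict_antimono[OF assms(2), of 0 z] archimedean_generatorD(6)[OF assms(2)] \<open>0 < z\<close> by simp
      ultimately obtain u where u: "0 < u" "\<psi>1 u = \<psi>2 z" using generator_surj[OF assms(1)] by blast
      then have "u = z" using eq[of u] generator_inj[OF assms(2) _ z, of u] pos by simp
      then show ?thesis using u by simp
    qed
  qed
  moreover have "A1 t = A2 t" if "t \<in> {0..1}" for t
  proof (cases "t = 0 \<or> t = 1")
    case True
    then show ?thesis using pickandsD(5,6)[OF assms(3)] pickandsD(5,6)[OF assms(5)] by auto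
  next
    case False
    then have t: "0 < t" "0 < 1 - t" using that by auto
    have "stdf A1 t (1 - t) = stdf A2 t (1 - t)"
      using tail[OF t] t \<open>\<theta> = 1\<close> stdf_pos[OF assms(3) t] by simp
    then show ?thesis by (simp add: stdf_on_simplex)
  qed
  ultimately show "(\<forall>z\<ge>0. \<psi>1 z = \<psi>2 z) \<and> (\<forall>t\<in>{0..1}. A1 t = A2 t)" by blast
qed

end
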